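(* Let $A$ and $B$ be semiprime $f$-algebras and let $T\in\mathcal{L}^{r}(A,B)$ be a separating operator. Then the following are equivalent: (i) $T$ is almost contractive; (ii) there exist $\omega\in\mathrm{Orth}(B)^{\sigma}$ and $C\in\mathfrak{C}(A,\mathrm{Q}(\mathrm{Orth}(B)^{\sigma}))$ such that $T=\omega C$, i.e. $T(f)=\omega\, C(f)$ in $\mathrm{Q}(\mathrm{Orth}(B)^{\sigma})$ for all $f\in A$.
   Context: All vector lattices ($f$-algebras) are real and Archimedean, and all operators are linear. An $f$-algebra is semiprime if $0$ is its only nilpotent element. For a semiprime $f$-algebra $B$, $\mathrm{Orth}(B)$ denotes the unital $f$-algebra of all orthomorphisms on $B$, whose unit element is the identity operator $I_B$; $B$ is regarded as a Riesz subspace and ring ideal of $\mathrm{Orth}(B)$ by identifying $f\in B$ with the multiplication operator $g\mapsto fg$. $\mathrm{Orth}(B)^{\sigma}$ denotes the Dedekind completion of $\mathrm{Orth}(B)$, which is a Dedekind complete unital $f$-algebra, and $\mathrm{Q}(\mathrm{Orth}(B)^{\sigma})$ denotes its maximal ring of quotients, with its natural $f$-algebra structure. Thus $B\subseteq \mathrm{Orth}(B)\subseteq \mathrm{Orth}(B)^{\sigma}\subseteq \mathrm{Q}(\mathrm{Orth}(B)^{\sigma})$ as $f$-subalgebras. For semiprime $f$-algebras $A,D$: $\mathcal{L}^{r}(A,D)$ is the ordered vector space of regular operators $A\to D$ (differences of two positive linear operators). An operator $T\in\mathcal{L}^{r}(A,D)$ is separating if $T(f)T(g)=0$ whenever $f,g\in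 A$ and $fg=0$. $\mathfrak{C}(A,D)$ is the set of composition operators, i.e. of all $C\in\mathcal{L}^{r}(A,D)$ with $C(fg)=C(f)C(g)$ for all $f,g\in A$. Let $U_A=\{f\in A: 0\le f\le I_A\}$ (order taken in $\mathrm{Orth}(A)$). An operator $T\in\mathcal{L}^{r}(A,B)$ is almost contractive if there exists $\omega\in\mathrm{Orth}(B)$ such that $|Tf|\le\omega$ for all $f\in U_A$. *)

theory Defs
  imports "HOL-Analysis.Analysis" "HOL-Library.Lattice_Algebras"
begin

section \<open>Archimedean f-algebras\<close>

(* lattice_ring supplies the lattice, the absolute value sup x (-x), and the fact that products
   of positive elements are positive. Neither a unit nor commutativity is assumed. *)
class f_algebra = lattice_ring + ordered_real_vector + real_algebra +
  assumes archimedean: "0 \<le> x \<Longrightarrow> (\<And>n::nat. real n *\<^sub>R x \<le> y) \<Longrightarrow> x = 0"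
    and f_mult_left: "inf x y = 0 \<Longrightarrow> 0 \<le> z \<Longrightarrow> inf (z * x) y = 0"
    and f_mult_right: "inf x y = 0 \<Longrightarrow> 0 \<le> z \<Longrightarrow> inf (x * z) y = 0"

(* In the absence of a unit, the power x ^ (n + 1) is written as the n-fold product
   x * (x * (... * x)). *)
definition (in f_algebra) nilpotent :: "'a \<Rightarrow> bool" where
  "nilpotent x \<longleftrightarrow> (\<exists>n::nat. (((*) x) ^^ n) x = 0)"

class semiprime_f_algebra = f_algebra +
  assumes semiprime: "nilpotent x \<Longrightarrow> x = 0"

(* Archimedean f-algebras are automatically commutative, so comm_ring is no restriction.
   Unlike real_algebra_1, this class does not exclude the zero algebra. *)
class unital_f_algebra = f_algebra + comm_ring + comm_monoid_mult


section \<open>Operators\<close>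

definition positive_op :: "('a::ordered_real_vector \<Rightarrow> 'b::ordered_real_vector) \<Rightarrow> bool" where
  "positive_op T \<longleftrightarrow> linear T \<and> (\<forall>x\<ge>0. 0 \<le> T x)"

definition regular_op :: "('a::ordered_real_vector \<Rightarrow> 'b::ordered_real_vector) \<Rightarrow> bool" where
  "regular_op T \<longleftrightarrow> (\<exists>P N. positive_op P \<and> positive_op N \<and> T = (\<lambda>x. P x - N x))"

definition separating :: "('a::f_algebra \<Rightarrow> 'b::f_algebra) \<Rightarrow> bool" where
  "separating T \<longleftrightarrow> (\<forall>f g. f * g = 0 \<longrightarrow> T f * T g = 0)"

definition composition_ops :: "('a::f_algebra \<Rightarrow> 'b::f_algebra) set" where
  "composition_ops = {C. regular_op C \<and> (\<forall>f g. C (f * g) = C f * C g)}"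


section \<open>Orthomorphisms\<close>

definition order_bounded_op :: "('a::f_algebra \<Rightarrow> 'b::f_algebra) \<Rightarrow> bool" where
  "order_bounded_op T \<longleftrightarrow> (\<forall>a b. \<exists>c d. T ` {a..b} \<subseteq> {c..d})"

definition Orth :: "('b::f_algebra \<Rightarrow> 'b) set" where
  "Orth = {\<pi>. linear \<pi> \<and> order_bounded_op \<pi> \<and>
     (\<forall>f g. inf \<bar>f\<bar> \<bar>g\<bar> = 0 \<longrightarrow> inf \<bar>\<pi> f\<bar> \<bar>g\<bar> = 0)}"

definition op_le :: "('a::f_algebra \<Rightarrow> 'b::f_algebra) \<Rightarrow> ('a \<Rightarrow> 'b) \<Rightarrow> bool" where
  "op_le S T \<longleftrightarrow> (\<forall>x\<ge>0. S x \<le> T x)"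

(* The embedding of a semiprime f-algebra into its orthomorphisms. *)
definition mult_op :: "'b::f_algebra \<Rightarrow> 'b \<Rightarrow> 'b" where
  "mult_op f = (\<lambda>g. f * g)"

(* The elements f of A with 0 \<le> f \<le> I, the second inequality being taken in Orth. *)
definition unit_interval :: "'a::semiprime_f_algebra set" where
  "unit_interval = {f. 0 \<le> f \<and> op_le (mult_op f) id}"

definition almost_contractive ::
    "('a::semiprime_f_algebra \<Rightarrow> 'b::semiprime_f_algebra) \<Rightarrow> bool" where
  "almost_contractive T \<longleftrightarrow>
     (\<exists>\<omega>\<in>Orth. \<forall>f\<in>unit_interval. op_le (mult_op \<bar>T f\<bar>) \<omega>)"


section \<open>Dedekind completion of the orthomorphisms\<close>

(* The map i exhibits the Dedekind complete unital f-algebra 'e as the Dedekind completion of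
   Orth: it is a unital algebra homomorphism and an order embedding whose image is order dense
   and majorizing. Such an i preserves the lattice operations: if \<sigma> is the supremum of \<pi>, \<rho> in
   Orth and i \<sigma> - sup (i \<pi>) (i \<rho>) > 0, then order density gives \<tau> with
   0 < i \<tau> \<le> i \<sigma> - sup (i \<pi>) (i \<rho>), and \<sigma> - \<tau> would be a smaller upper bound of \<pi> and \<rho>. The
   values of i outside Orth are irrelevant. *)
definition dedekind_completion_of_Orth ::
    "(('b::f_algebra \<Rightarrow> 'b) \<Rightarrow> 'e::{unital_f_algebra, conditionally_complete_lattice}) \<Rightarrow> bool" where
  "dedekind_completion_of_Orth i \<longleftrightarrow>
     (\<forall>\<pi>\<in>Orth. \<forall>\<rho>\<in>Orth. i (\<lambda>x. \<pi> x + \<rho> x) = i \<pi> + i \<rho>) \<and>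
     (\<forall>r. \<forall>\<pi>\<in>Orth. i (\<lambda>x. r *\<^sub>R \<pi> x) = r *\<^sub>R i \<pi>) \<and>
     (\<forall>\<pi>\<in>Orth. \<forall>\<rho>\<in>Orth. i (\<pi> \<circ> \<rho>) = i \<pi> * i \<rho>) \<and>
     i id = 1 \<and>
     (\<forall>\<pi>\<in>Orth. \<forall>\<rho>\<in>Orth. i \<pi> \<le> i \<rho> \<longleftrightarrow> op_le \<pi> \<rho>) \<and>
     (\<forall>x>0. \<exists>\<pi>\<in>Orth. 0 < i \<pi> \<and> i \<pi> \<le> x) \<and>
     (\<forall>x. \<exists>\<pi>\<in>Orth. x \<le> i \<pi>)"


section \<open>Maximal ring of quotients\<close>

definition dense_ideal :: "'r::{comm_ring, comm_monoid_mult} set \<Rightarrow> bool" where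
  "dense_ideal D \<longleftrightarrow>
     0 \<in> D \<and> (\<forall>x\<in>D. \<forall>y\<in>D. x + y \<in> D) \<and> (\<forall>r. \<forall>x\<in>D. r * x \<in> D) \<and>
     (\<forall>r. (\<forall>x\<in>D. r * x = 0) \<longrightarrow> r = 0)"

definition fraction :: "'r::{comm_ring, comm_monoid_mult} set \<Rightarrow> ('r \<Rightarrow> 'r) \<Rightarrow> bool" where
  "fraction D \<phi> \<longleftrightarrow> dense_ideal D \<and>
     (\<forall>x\<in>D. \<forall>y\<in>D. \<phi> (x + y) = \<phi> x + \<phi> y) \<and> (\<forall>r. \<forall>x\<in>D. \<phi> (r * x) = r * \<phi> x)"

(* The maximal (complete) ring of quotients of a commutative ring R is the direct limit of
   Hom(D, R) over the dense ideals D of R. An extension j of R is isomorphic to it over R iff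
   every fraction is multiplication by exactly one element of the extension and every element of
   the extension arises in this way. *)
definition maximal_quotient_ring ::
    "('r::{comm_ring, comm_monoid_mult} \<Rightarrow> 'q::{comm_ring, comm_monoid_mult}) \<Rightarrow> bool" where
  "maximal_quotient_ring j \<longleftrightarrow>
     inj j \<and> (\<forall>x y. j (x + y) = j x + j y) \<and> (\<forall>x y. j (x * y) = j x * j y) \<and> j 1 = 1 \<and>
     (\<forall>D \<phi>. fraction D \<phi> \<longrightarrow> (\<exists>!q. \<forall>x\<in>D. q * j x = j (\<phi> x))) \<and>
     (\<forall>q. \<exists>D \<phi>. fraction D \<phi> \<and> (\<forall>x\<in>D. q * j x = j (\<phi> x)))"

definition f_algebra_embedding :: "('e::f_algebra \<Rightarrow> 'q::f_algebra) \<Rightarrow> bool" where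
  "f_algebra_embedding j \<longleftrightarrow> linear j \<and> inj j \<and>
     (\<forall>x y. j (x * y) = j x * j y) \<and> (\<forall>x y. j (sup x y) = sup (j x) (j y))"

(* The natural f-algebra structure of the maximal ring of quotients is the only one that makes
   the canonical map an f-algebra embedding: q \<ge> 0 holds iff q * j d * j d \<ge> 0 for all d in
   some (equivalently, every) dense ideal that q multiplies into the range of j, and
   r *\<^sub>R q = j (r *\<^sub>R 1) * q. *)
definition maximal_quotient_f_algebra ::
    "('e::unital_f_algebra \<Rightarrow> 'q::unital_f_algebra) \<Rightarrow> bool" where
  "maximal_quotient_f_algebra j \<longleftrightarrow> maximal_quotient_ring j \<and> f_algebra_embedding j"

end

(* Write T also for its composition with the embedding B \<rightarrow> Orth B \<rightarrow> E := Orth(B)^\<sigma>. A regular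
   separating T satisfies T f * T g \<ge> 0 for f, g \<ge> 0. Applied to the positive and negative parts of
   h * g - t h and g * f - t f, this gives (T (h * g) - t T h) * (T (g * f) - t T f) \<ge> 0 for all real
   t \<ge> 0, and a discriminant argument yields the identity T (h * g) * T f = T h * T (g * f). Hence
   T g \<mapsto> T (g * f), extended by 0 on the annihilator of the range of T, is a fraction over E; it
   defines C f in the ring of quotients, and C is positive and multiplicative.

   For almost contractive T, the supremum over u in the unit interval of the positive parts of T u,
   minus the corresponding supremum of the negative parts, is an \<omega> in E with
   \<omega> * T (g * h) = T g * T h. The lower bound tests u = (2 a g - a^2 g^2)^+ for all real a > 0; almost
   contractivity enters once more as a \<rightarrow> \<infinity>, where C g vanishes.

   Conversely, if 0 \<le> f \<le> I, then the powers of C f are values of C on {0..f}, hence bounded, which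
   forces |C f| \<le> 1 and |T f| \<le> |\<omega>|. *)

theory Submission
  imports Defs
begin

section \<open>Arithmetic of f-algebras\<close>

context lattice_ab_group_add
begin

lemma pprt_diff_pprt_minus: "pprt x - pprt (- x) = x"
  using prts[of x] by (simp add: pprt_neg)

lemma inf_diff_inf_eq_0: "inf (x - inf x y) (y - inf x y) = 0"
  using add_inf_distrib_right[of x y "- inf x y"] by (metis add.right_inverse diff_conv_add_uminus)

lemma inf_pprt_pprt_minus: "inf (pprt x) (pprt (- x)) = 0"
proof -
  have "x - inf x 0 = pprt x"
    using prts[of x] by (metis add_diff_cancel_right' nprt_def)
  moreover have "0 - inf x 0 = pprt (- x)"
    by (simp add: pprt_neg nprt_def)
  ultimately show ?thesis
    using inf_diff_inf_eq_0[of x 0] by metis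
qed

text \<open>For disjoint elements the supremum is the sum. This is the uniqueness of the
  decomposition into disjoint positive and negative parts.\<close>

lemma pprt_diff_eq:
  assumes "inf a b = 0"
  shows "pprt (a - b) = a"
proof -
  have "pprt (a - b) = sup a b - b"
    using add_sup_distrib_right[of a b "- b"] by (simp add: pprt_def)
  also have "sup a b = a + b"
    using add_eq_inf_sup[of a b] assms by simp
  finally show ?thesis by simp
qed

lemma inf_eq_0_mono:
  assumes "inf a b = 0" "0 \<le> c" "c \<le> a" "0 \<le> d" "d \<le> b"
  shows "inf c d = 0"
  using assms by (metis inf_mono inf_greatest order.antisym)

lemma inf_eq_0_add:
  assumes "inf a c = 0" "inf b c = 0"
  shows "inf (a + b) c = 0"
proof -
  have nn: "0 \<le> a" "0 \<le> b" "0 \<le> c"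
    using assms by (metis inf_le1 inf_le2)+
  have "inf (a + b) c \<le> inf (a + b) (a + c)"
    using nn by (simp add: add_increasing inf.coboundedI2)
  also have "\<dots> = a + inf b c"
    by (simp add: add_inf_distrib_left)
  finally have "inf (a + b) c \<le> inf a c"
    by (simp add: assms(2))
  then have "inf (a + b) c \<le> 0"
    by (simp only: assms(1))
  moreover have "0 \<le> inf (a + b) c"
    using nn by simp
  ultimately show ?thesis
    by (rule order.antisym)
qed

end

lemma abs_eq_pprt_add: "\<bar>x\<bar> = pprt x + pprt (- x)"
  for x :: "'a::lattice_ab_group_add_abs"
  by (simp add: abs_prts pprt_neg)

section \<open>Products, positive parts and absolute values\<close>

context f_algebra
begin

text \<open>The two f-algebra axioms, applied in turn, make \<open>x * y\<close> disjoint from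
  \<open>y\<close> and then from itself.\<close>

lemma mult_eq_0_of_inf_eq_0:
  assumes "inf x y = 0"
  shows "x * y = 0"
proof -
  have nn: "0 \<le> x" "0 \<le> y"
    using assms by (metis inf_le1 inf_le2)+
  have "inf (x * y) y = 0"
    using f_mult_right assms nn by blast
  then have "inf (x * y) (x * y) = 0"
    using f_mult_left[of y "x * y" x] nn by (simp add: inf_commute)
  then show ?thesis by simp
qed

lemma pprt_mult_pprt_minus: "pprt x * pprt (- x) = 0" "pprt (- x) * pprt x = 0"
  using mult_eq_0_of_inf_eq_0[OF inf_pprt_pprt_minus[of x]]
    mult_eq_0_of_inf_eq_0[OF inf_pprt_pprt_minus[of "- x"]] by simp_all

text \<open>Multiplication by \<open>z\<close> keeps the two parts of \<open>x\<close> disjoint, and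
  a difference of disjoint elements has these elements as its parts.\<close>

lemma pprt_mult_left:
  assumes "0 \<le> z"
  shows "pprt (z * x) = z * pprt x"
proof -
  have "inf (z * pprt x) (pprt (- x)) = 0"
    using f_mult_left inf_pprt_pprt_minus assms by blast
  then have "inf (z * pprt x) (z * pprt (- x)) = 0"
    using f_mult_left assms by (metis inf_commute)
  then have "pprt (z * pprt x - z * pprt (- x)) = z * pprt x"
    by (rule pprt_diff_eq)
  then show ?thesis
    by (metis pprt_diff_pprt_minus right_diff_distrib)
qed

lemma pprt_mult_right:
  assumes "0 \<le> z"
  shows "pprt (x * z) = pprt x * z"
proof -
  have "inf (pprt x * z) (pprt (- x)) = 0"
    using f_mult_right inf_pprt_pprt_minus assms by blast
  then have "inf (pprt x * z) (pprt (- x) * z) = 0"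
    using f_mult_right assms by (metis inf_commute)
  then have "pprt (pprt x * z - pprt (- x) * z) = pprt x * z"
    by (rule pprt_diff_eq)
  then show ?thesis
    by (metis pprt_diff_pprt_minus left_diff_distrib)
qed

lemma pprt_mult_self: "pprt x * x = pprt x * pprt x"
proof -
  have "pprt x * x = pprt x * (pprt x - pprt (- x))"
    by (simp add: pprt_diff_pprt_minus)
  also have "\<dots> = pprt x * pprt x"
    using pprt_mult_pprt_minus[of x] by (simp add: right_diff_distrib)
  finally show ?thesis .
qed

lemma square_nonneg: "0 \<le> x * x"
proof -
  have "x * x = (pprt x - pprt (- x)) * (pprt x - pprt (- x))"
    by (simp add: pprt_diff_pprt_minus)
  also have "\<dots> = pprt x * pprt x + pprt (- x) * pprt (- x)"
    using pprt_mult_pprt_minus[of x] by (simp add: algebra_simps)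
  finally show ?thesis by simp
qed

end

lemma abs_mult_left: "0 \<le> z \<Longrightarrow> \<bar>z * x\<bar> = z * \<bar>x\<bar>"
  for x :: "'a::f_algebra"
  using pprt_mult_left[of z x] pprt_mult_left[of z "- x"]
  by (simp add: abs_eq_pprt_add distrib_left)

lemma abs_mult_right: "0 \<le> z \<Longrightarrow> \<bar>x * z\<bar> = \<bar>x\<bar> * z"
  for x :: "'a::f_algebra"
  using pprt_mult_right[of z x] pprt_mult_right[of z "- x"]
  by (simp add: abs_eq_pprt_add distrib_right)

text \<open>It suffices to split \<open>x\<close>: the products of its parts with \<open>y\<close>
  are disjoint, and the absolute value of a difference of disjoint elements is the sum of their
  absolute values.\<close>

lemma f_abs_mult: "\<bar>x * y\<bar> = \<bar>x\<bar> * \<bar>y\<bar>"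
  for x :: "'a::f_algebra"
proof -
  let ?p = "pprt x" and ?n = "pprt (- x)"
  have x: "inf ?p ?n = 0" by (rule inf_pprt_pprt_minus)
  have "inf (?p * \<bar>y\<bar>) (?n * \<bar>y\<bar>) = 0"
    using f_mult_right[OF x, of "\<bar>y\<bar>"] f_mult_right[of ?n "?p * \<bar>y\<bar>" "\<bar>y\<bar>"]
    by (simp add: inf_commute)
  then have *: "inf \<bar>?p * y\<bar> \<bar>?n * y\<bar> = 0"
    by (simp add: abs_mult_left)
  have "\<bar>a - b\<bar> = \<bar>a\<bar> + \<bar>b\<bar>" if d: "inf \<bar>a\<bar> \<bar>b\<bar> = 0" for a b :: 'a
  proof -
    have le: "pprt c \<le> \<bar>c\<bar>" "pprt (-c) \<le> \<bar>c\<bar>" for c :: 'a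
      by (simp_all add: abs_eq_pprt_add)
    have dd: "inf u v = 0" if "u \<in> {pprt a, pprt (-a)}" "v \<in> {pprt b, pprt (-b)}" for u v
      using that le by (auto intro!: inf_eq_0_mono[OF d])
    \<comment> \<open>Each part of \<open>a\<close> is paired with the opposite part of
      \<open>b\<close>, which gives the two parts of \<open>a - b\<close>.\<close>
    define u v where "u = pprt a + pprt (-b)" and "v = pprt (-a) + pprt b"
    have "inf u v = 0" unfolding u_def v_def
      using dd inf_pprt_pprt_minus[of a] inf_pprt_pprt_minus[of b]
      by (intro inf_eq_0_add) (subst inf_commute, intro inf_eq_0_add; simp add: inf_commute)+
    then have "pprt (u - v) = u" "pprt (v - u) = v"
      by (auto intro: pprt_diff_eq simp: inf_commute)
    moreover have "u - v = a - b"
      using pprt_diff_pprt_minus[of a] pprt_diff_pprt_minus[of b]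
      by (simp add: u_def v_def algebra_simps)
    ultimately have "\<bar>a - b\<bar> = u + v"
      by (metis abs_eq_pprt_add minus_diff_eq)
    then show ?thesis
      by (simp add: abs_eq_pprt_add u_def v_def ac_simps)
  qed
  from this[OF *] have "\<bar>?p * y - ?n * y\<bar> = (?p + ?n) * \<bar>y\<bar>"
    by (simp add: abs_mult_left distrib_right)
  then show ?thesis
    by (metis abs_eq_pprt_add left_diff_distrib pprt_diff_pprt_minus)
qed

section \<open>Real multiples and the Archimedean property\<close>

lemma pprt_scaleR:
  fixes x :: "'a::f_algebra"
  assumes "0 \<le> r"
  shows "pprt (r *\<^sub>R x) = r *\<^sub>R pprt x"
proof (cases "r = 0")
  case False
  with assms have r: "r > 0" by simp
  let ?m = "inf (r *\<^sub>R pprt x) (r *\<^sub>R pprt (- x))"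
  have "(1 / r) *\<^sub>R ?m \<le> (1 / r) *\<^sub>R (r *\<^sub>R pprt x)" "(1 / r) *\<^sub>R ?m \<le> (1 / r) *\<^sub>R (r *\<^sub>R pprt (- x))"
    using r by (intro scaleR_left_mono; simp)+
  then have "(1 / r) *\<^sub>R ?m \<le> inf (pprt x) (pprt (- x))"
    using r by simp
  then have "(1 / r) *\<^sub>R ?m \<le> 0"
    by (simp add: inf_pprt_pprt_minus)
  then have "r *\<^sub>R ((1 / r) *\<^sub>R ?m) \<le> r *\<^sub>R 0"
    using r by (intro scaleR_left_mono) auto
  then have "?m \<le> 0" using r by simp
  moreover have "0 \<le> ?m" using r by (simp add: scaleR_nonneg_nonneg)
  ultimately have "pprt (r *\<^sub>R pprt x - r *\<^sub>R pprt (- x)) = r *\<^sub>R pprt x"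
    by (intro pprt_diff_eq) simp
  then show ?thesis
    by (metis pprt_diff_pprt_minus scaleR_right_diff_distrib)
qed auto

text \<open>The class axiom speaks of positive elements. Taking positive parts in the hypothesis
  extends it to arbitrary \<open>x\<close>.\<close>

lemma archimedean_le_0:
  fixes x y :: "'a::f_algebra"
  assumes "\<And>n::nat. real n *\<^sub>R x \<le> y"
  shows "x \<le> 0"
proof -
  have "real n *\<^sub>R pprt x \<le> pprt y" for n
    using pprt_mono[OF assms[of n]] by (simp add: pprt_scaleR)
  then have "pprt x = 0"
    using archimedean[of "pprt x" "pprt y"] by simp
  then show ?thesis by (simp add: le_zero_iff_zero_pprt)
qed

lemma le_0_of_scaleR_le:
  fixes x y :: "'a::f_algebra"
  assumes "\<And>t. 0 < t \<Longrightarrow> t *\<^sub>R x \<le> y"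
  shows "x \<le> 0"
proof (rule archimedean_le_0)
  fix n :: nat
  \<comment> \<open>The bound is raised to \<open>pprt y\<close> because the case
    \<open>n = 0\<close> asks for a nonnegative one.\<close>
  show "real n *\<^sub>R x \<le> pprt y"
    using assms[of "real n"] by (cases "n = 0") (auto simp: pprt_def intro: le_supI1)
qed

lemma le_0_of_le_scaleR:
  fixes x y :: "'a::f_algebra"
  assumes "\<And>t. 0 < t \<Longrightarrow> x \<le> t *\<^sub>R y"
  shows "x \<le> 0"
proof (rule le_0_of_scaleR_le)
  fix t :: real assume "0 < t"
  then have "t *\<^sub>R x \<le> t *\<^sub>R ((1 / t) *\<^sub>R y)"
    using assms[of "1 / t"] by (intro scaleR_left_mono) auto
  then show "t *\<^sub>R x \<le> y" using \<open>0 < t\<close> by simp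
qed

section \<open>Nilpotent elements\<close>

lemma inf_eq_0_of_mult_eq_0:
  fixes u v :: "'a::semiprime_f_algebra"
  assumes "0 \<le> u" "0 \<le> v" "u * v = 0"
  shows "inf u v = 0"
proof -
  have "inf u v * inf u v \<le> u * v"
    using assms by (intro mult_mono) auto
  then have "inf u v * inf u v = 0"
    using assms square_nonneg[of "inf u v"] by simp
  \<comment> \<open>The count in \<open>nilpotent\<close> starts at the element itself, so the index
    1 stands for the square.\<close>
  then have "nilpotent (inf u v)"
    by (auto simp: nilpotent_def intro!: exI[of _ 1])
  then show ?thesis by (rule semiprime)
qed

text \<open>If \<open>y\<close> has square zero, then the nonnegative square of
  \<open>1 - real n *\<^sub>R y\<close> bounds every multiple of \<open>y + y\<close> by 1. Hence
  unital Archimedean f-algebras are semiprime.\<close>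

lemma unital_square_eq_0:
  fixes x :: "'a::unital_f_algebra"
  assumes "x * x = 0"
  shows "x = 0"
proof -
  have *: "y \<le> 0" if y: "y * y = 0" for y :: 'a
  proof -
    have "y + y \<le> 0"
    proof (rule archimedean_le_0)
      fix n :: nat
      have "0 \<le> (1 - real n *\<^sub>R y) * (1 - real n *\<^sub>R y)"
        by (rule square_nonneg)
      also have "\<dots> = 1 - real n *\<^sub>R (y + y)"
        by (simp add: algebra_simps y)
      finally show "real n *\<^sub>R (y + y) \<le> 1"
        by simp
    qed
    then show ?thesis by simp
  qed
  show ?thesis
    using *[of x] *[of "- x"] assms by simp
qed


lemma unital_cube_eq_0: "x * x * x = 0 \<Longrightarrow> x = 0"
  for x :: "'a::unital_f_algebra"
  by (metis mult.assoc mult_zero_left unital_square_eq_0)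

lemma mult_eq_0_of_square_mult:
  fixes v x :: "'a::unital_f_algebra"
  assumes "v * v * x = 0"
  shows "v * x = 0"
  by (rule unital_square_eq_0) (metis assms mult.assoc mult.commute mult_zero_left)

section \<open>Gap and discriminant arguments\<close>

text \<open>In the representation by functions, a point where \<open>D > 0\<close> and \<open>a > 0\<close> would force
  \<open>t * a - b\<close> to jump over a fixed gap around \<open>0\<close> as \<open>t\<close> runs through a fine grid.\<close>

lemma mult_eq_0_of_le_square:
  fixes a b D K :: "'a::unital_f_algebra"
  assumes a: "0 \<le> a" and b: "0 \<le> b" and D: "0 \<le> D" and K: "0 \<le> K"
    and le: "\<And>t. 0 \<le> t \<Longrightarrow> D \<le> K * ((t *\<^sub>R a - b) * (t *\<^sub>R a - b))"
  shows "D * a = 0"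
proof -
  have "D * a \<le> e *\<^sub>R (a * a * K * a)" if "0 < e" "e \<le> 1" for e
  proof -
    \<comment> \<open>On the support of \<open>v\<close>, \<open>D\<close> exceeds every value of
      \<open>K * (x * x)\<close> with \<open>x\<close> within one grid step
      \<open>e *\<^sub>R a\<close> of 0.\<close>
    define v where "v = pprt (D - (e * e) *\<^sub>R (a * a * K))"
    have v0: "0 \<le> v" by (simp add: v_def)
    have step: "v * pprt ((real k * e) *\<^sub>R a - b) = 0" for k
    proof (induction k)
      case 0
      then show ?case using b by simp
    next
      case (Suc k)
      define x where "x = (real k * e) *\<^sub>R a - b"
      define x' where "x' = (real (Suc k) * e) *\<^sub>R a - b"
      define y where "y = pprt x'"
      \<comment> \<open>A sign change \<open>x \<le> 0 < x'\<close> on the support of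
        \<open>v\<close> would put \<open>x\<close> within one grid step of 0, against the choice of
        \<open>v\<close>. The elements \<open>n\<close> and \<open>y\<close> measure the two sides
        of such a change.\<close>
      define n where "n = - (v * x)"
      have y0: "0 \<le> y" by (simp add: y_def)
      have x': "x' = x + e *\<^sub>R a" by (simp add: x_def x'_def algebra_simps)
      have "v * pprt x = 0" using Suc by (simp add: x_def)
      then have "pprt (v * x) = 0" by (simp add: pprt_mult_left v0)
      then have n0: "0 \<le> n" by (simp add: n_def flip: le_zero_iff_zero_pprt)
      have "n * y = v * y * (e *\<^sub>R a) - v * (y * x')"
        by (simp add: n_def x' algebra_simps)
      also have "y * x' = y * y" by (simp add: y_def pprt_mult_self)
      also have "v * y * (e *\<^sub>R a) - v * (y * y) \<le> v * y * (e *\<^sub>R a)"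
        using v0 y0 by simp
      finally have ny: "n * y \<le> e *\<^sub>R (v * y * a)" by simp
      have "n * (n * y) \<le> n * (e *\<^sub>R (v * y * a))"
        using ny n0 by (rule mult_left_mono)
      also have "\<dots> = e *\<^sub>R (v * a) * (n * y)" by (simp add: ac_simps)
      also have "\<dots> \<le> e *\<^sub>R (v * a) * (e *\<^sub>R (v * y * a))"
        using ny v0 a \<open>0 < e\<close> by (intro mult_left_mono scaleR_nonneg_nonneg mult_nonneg_nonneg) auto
      finally have nny: "n * n * y \<le> (e * e) *\<^sub>R (a * a) * (v * v * y)"
        by (simp add: ac_simps)
      have "(v * v * y) * D \<le> (v * v * y) * (K * (x * x))"
        using le[of "real k * e"] v0 y0 \<open>0 < e\<close> by (intro mult_left_mono) (auto simp: x_def)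
      also have "\<dots> = K * (n * n * y)" by (simp add: n_def ac_simps)
      also have "\<dots> \<le> K * ((e * e) *\<^sub>R (a * a) * (v * v * y))"
        using nny K by (rule mult_left_mono)
      also have "\<dots> = (v * v * y) * ((e * e) *\<^sub>R (a * a * K))" by (simp add: ac_simps)
      finally have "v * y * (v * (D - (e * e) *\<^sub>R (a * a * K))) \<le> 0"
        by (simp add: right_diff_distrib ac_simps)
      moreover have "v * (D - (e * e) *\<^sub>R (a * a * K)) = v * v"
        unfolding v_def by (rule pprt_mult_self)
      ultimately have "v * y * (v * v) \<le> 0"
        by (simp only:)
      moreover have "0 \<le> v * y * (v * v)"
        using v0 y0 by (intro mult_nonneg_nonneg)
      ultimately have "v * y * (v * v) = 0"
        by (rule order.antisym)
      then have "v * v * (v * y) = 0"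
        by (simp only: mult.commute)
      then have "v * v * y = 0"
        using mult_eq_0_of_square_mult[of v "v * y"] by (simp add: mult.assoc)
      then have "v * y = 0"
        by (rule mult_eq_0_of_square_mult)
      then show ?case
        by (simp only: y_def x'_def)
    qed
    \<comment> \<open>As no sign change occurs, all multiples of \<open>e *\<^sub>R a\<close> stay
      below \<open>b\<close> on the support of \<open>v\<close>.\<close>
    have "e *\<^sub>R (v * a) \<le> 0"
    proof (rule archimedean_le_0)
      fix k :: nat
      have "pprt (v * ((real k * e) *\<^sub>R a - b)) = 0"
        using step[of k] by (simp add: pprt_mult_left v0)
      then show "real k *\<^sub>R (e *\<^sub>R (v * a)) \<le> v * b"
        by (simp add: right_diff_distrib flip: le_zero_iff_zero_pprt)
    qed
    then have "(1 / e) *\<^sub>R (e *\<^sub>R (v * a)) \<le> (1 / e) *\<^sub>R 0"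
      using \<open>0 < e\<close> by (intro scaleR_left_mono) auto
    then have "v * a \<le> 0" using \<open>0 < e\<close> by simp
    moreover have "(D - (e * e) *\<^sub>R (a * a * K)) * a \<le> v * a"
      using a by (intro mult_right_mono) (auto simp: v_def pprt_def)
    ultimately have "(D - (e * e) *\<^sub>R (a * a * K)) * a \<le> 0"
      by simp
    then have "D * a \<le> (e * e) *\<^sub>R (a * a * K * a)"
      by (simp add: left_diff_distrib)
    also have "\<dots> \<le> e *\<^sub>R (a * a * K * a)"
      using that a K by (intro scaleR_right_mono) (auto simp: mult_le_one)
    finally show ?thesis .
  qed
  note bound = this
  have "D * a \<le> 0"
  proof (rule archimedean_le_0)
    fix n :: nat
    \<comment> \<open>The successor keeps the mesh positive and at most 1, also for
      \<open>n = 0\<close>.\<close>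
    have "D * a \<le> (1 / real (Suc n)) *\<^sub>R (a * a * K * a)"
      by (rule bound) auto
    then have "real (Suc n) *\<^sub>R (D * a) \<le> real (Suc n) *\<^sub>R ((1 / real (Suc n)) *\<^sub>R (a * a * K * a))"
      by (intro scaleR_left_mono) auto
    then have "real (Suc n) *\<^sub>R (D * a) \<le> a * a * K * a" by simp
    moreover have "real n *\<^sub>R (D * a) \<le> real (Suc n) *\<^sub>R (D * a)"
      using D a by (intro scaleR_right_mono) auto
    ultimately show "real n *\<^sub>R (D * a) \<le> a * a * K * a" by simp
  qed
  then show ?thesis using D a by (simp add: order.antisym)
qed

text \<open>Four times \<open>F * H\<close> times the quadratic polynomial in \<open>t\<close> is
  \<open>(t *\<^sub>R a - b)^2 - W^2\<close>, so the gap argument yields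
  \<open>W * W * (F * H) = 0\<close>. On the support of \<open>W\<close> the polynomial is then
  affine; being nonnegative for all \<open>t \<ge> 0\<close>, it forces \<open>b = 0\<close> there,
  and \<open>W\<close> vanishes with \<open>b\<close>.\<close>

lemma mult_eq_of_affine_products_nonneg:
  fixes F F' H H' :: "'a::unital_f_algebra"
  assumes FH: "0 \<le> F * H" and F'H: "0 \<le> F' * H" and FH': "0 \<le> F * H'"
    and le: "\<And>t. 0 \<le> t \<Longrightarrow> 0 \<le> (H' - t *\<^sub>R H) * (F' - t *\<^sub>R F)"
  shows "F' * H = F * H'"
proof -
  define W where "W = F' * H - F * H'"
  define b where "b = F' * H + F * H'"
  define a where "a = F * H + F * H"
  have b0: "0 \<le> b" and a0: "0 \<le> a" using assms by (simp_all add: a_def b_def)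
  have "W * W \<le> 1 * ((t *\<^sub>R a - b) * (t *\<^sub>R a - b))" if "0 \<le> t" for t
  proof -
    have "0 \<le> F * H * ((H' - t *\<^sub>R H) * (F' - t *\<^sub>R F))" (is "0 \<le> ?z")
      using FH le[OF that] by (rule mult_nonneg_nonneg)
    then have "0 \<le> ?z + ?z + (?z + ?z)" by simp
    also have "\<dots> = (t *\<^sub>R a - b) * (t *\<^sub>R a - b) - W * W"
      by (simp add: a_def b_def W_def algebra_simps)
    finally show ?thesis by simp
  qed
  then have "W * W * a = 0"
    using a0 b0 square_nonneg[of W] square_nonneg[of "1::'a"]
    by (intro mult_eq_0_of_le_square[where K = 1 and b = b]) auto
  then have WFH: "W * W * (F * H) = 0"
    by (simp add: a_def distrib_left)
  have "W * W * b \<le> 0"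
  proof (rule le_0_of_scaleR_le)
    fix t :: real assume "0 < t"
    then have "0 \<le> W * W * ((H' - t *\<^sub>R H) * (F' - t *\<^sub>R F))"
      using le[of t] square_nonneg[of W] by simp
    also have "\<dots> = W * W * (H' * F') - t *\<^sub>R (W * W * b) + (t * t) *\<^sub>R (W * W * (F * H))"
      by (simp add: b_def algebra_simps)
    finally show "t *\<^sub>R (W * W * b) \<le> W * W * (H' * F')"
      by (simp add: WFH)
  qed
  moreover have p: "0 \<le> W * W * (F' * H)" "0 \<le> W * W * (F * H')"
    using square_nonneg[of W] F'H FH' by simp_all
  ultimately have "W * W * (F' * H) + W * W * (F * H') = 0"
    by (intro order.antisym) (simp_all add: b_def distrib_left)
  then have "W * W * (F' * H) = 0" "W * W * (F * H') = 0"
    using p by (simp_all add: add_nonneg_eq_0_iff)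
  then have "W * W * W = 0"
    by (subst (3) W_def) (simp add: right_diff_distrib)
  then show ?thesis
    using unital_cube_eq_0 by (fastforce simp: W_def)
qed


section \<open>Separating operators\<close>

text \<open>The target is unital, so squares can be cancelled in it. An operator into a semiprime
  algebra enters after its target is embedded into the completion of the orthomorphisms.\<close>

locale regular_separating =
  fixes T :: "'a::semiprime_f_algebra \<Rightarrow> 'e::unital_f_algebra"
  assumes reg: "regular_op T" and sep: "separating T"
begin

lemma linear: "linear T"
  using reg by (auto simp: regular_op_def positive_op_def intro: linear_compose_sub)

lemma add: "T (x + y) = T x + T y" and diff: "T (x - y) = T x - T y"
  and scale: "T (r *\<^sub>R x) = r *\<^sub>R T x" and zero: "T 0 = 0"
  using linear by (simp_all add: linear_add linear_diff linear_scale linear_0)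

lemma mult_eq_0: "f * g = 0 \<Longrightarrow> T f * T g = 0"
  using sep by (simp add: separating_def)

text \<open>The sum of the two positive operators in a decomposition of \<open>T\<close> takes the
  place of its modulus, which need not exist when the target is not Dedekind complete.\<close>

lemma dominated:
  obtains S where "linear S" "\<And>x y. x \<le> y \<Longrightarrow> S x \<le> S y" "\<And>x. 0 \<le> x \<Longrightarrow> \<bar>T x\<bar> \<le> S x"
proof -
  obtain P N where P: "positive_op P" and N: "positive_op N" and T: "T = (\<lambda>x. P x - N x)"
    using reg by (auto simp: regular_op_def)
  define S where "S = (\<lambda>x. P x + N x)"
  have lin: "linear S"
    using P N by (auto simp: S_def positive_op_def intro: linear_compose_add)
  show thesis
  proof (rule that)
    show "linear S" by fact
    show "S x \<le> S y" if "x \<le> y" for x y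
    proof -
      have "0 \<le> S (y - x)" using P N that by (simp add: S_def positive_op_def)
      then show ?thesis using lin by (simp add: linear_diff)
    qed
    show "\<bar>T x\<bar> \<le> S x" if "0 \<le> x" for x
    proof -
      have "0 \<le> P x" "0 \<le> N x" using P N that by (simp_all add: positive_op_def)
      moreover from this have "\<bar>P x - N x\<bar> \<le> \<bar>P x\<bar> + \<bar>N x\<bar>" by (intro abs_triangle_ineq4)
      ultimately show ?thesis by (simp add: T S_def)
    qed
  qed
qed

text \<open>Multiplication by \<open>z\<close> localizes \<open>T\<close> to the support of
  \<open>z\<close> and preserves separation.\<close>

lemma mult_left_op: "regular_separating (\<lambda>x. z * T x)"  if "0 \<le> z"
proof
  obtain P N where P: "positive_op P" and N: "positive_op N" and T: "T = (\<lambda>x. P x - N x)"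
    using reg by (auto simp: regular_op_def)
  have *: "positive_op (\<lambda>x. z * R x)" if "positive_op R" for R :: "'a \<Rightarrow> 'e"
    using that \<open>0 \<le> z\<close> by (auto simp: positive_op_def linear_iff distrib_left)
  show "regular_op (\<lambda>x. z * T x)"
    unfolding regular_op_def
    by (rule exI[of _ "\<lambda>x. z * P x"], rule exI[of _ "\<lambda>x. z * N x"])
      (use * P N in \<open>auto simp: T right_diff_distrib\<close>)
  show "separating (\<lambda>x. z * T x)"
    using sep by (auto simp: separating_def) (metis mult.left_commute mult.assoc mult_zero_right)
qed

text \<open>With \<open>d t = T (pprt (f - t *\<^sub>R g))\<close>, separation forces \<open>d t\<close> to be \<open>0\<close> or \<open>T f - t *\<^sub>R T g\<close> at
  each point of a representation. By domination \<open>d\<close> is continuous in \<open>t\<close> and bounded, so the second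
  alternative persists from \<open>t = 0\<close> on and forces \<open>T g = 0\<close>.\<close>

lemma opposite_signs_mult_eq_0:
  assumes f: "0 \<le> f" and g: "0 \<le> g" and F: "0 \<le> T f" and G: "T g \<le> 0"
  shows "T f * T g = 0"
proof -
  obtain S where S: "linear S" and mono: "\<And>x y. x \<le> y \<Longrightarrow> S x \<le> S y"
    and dom: "\<And>x. 0 \<le> x \<Longrightarrow> \<bar>T x\<bar> \<le> S x"
    using dominated by blast
  define d where "d t = T (pprt (f - t *\<^sub>R g))" for t
  have d_mult: "d t * (d t - (T f - t *\<^sub>R T g)) = 0" for t
  proof -
    let ?x = "f - t *\<^sub>R g"
    have "T f - t *\<^sub>R T g = T ?x" by (simp add: diff scale)
    also have "\<dots> = T (pprt ?x - pprt (- ?x))" by (simp only: pprt_diff_pprt_minus)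
    also have "\<dots> = d t - T (pprt (- ?x))" by (simp add: d_def diff)
    finally show ?thesis
      using mult_eq_0[OF pprt_mult_pprt_minus(1), of ?x] by (simp add: d_def)
  qed
  have d_bound: "d t \<le> S f" if "0 \<le> t" for t
  proof -
    have "pprt (f - t *\<^sub>R g) \<le> f"
      using f g that by (simp add: pprt_def scaleR_nonneg_nonneg)
    then show ?thesis
      using dom[of "pprt (f - t *\<^sub>R g)"] mono abs_ge_self
      by (fastforce simp: d_def intro: order_trans)
  qed
  have d_cont: "d s - (t - s) *\<^sub>R S g \<le> d t" if "s \<le> t" for s t
  proof -
    let ?w = "pprt (f - s *\<^sub>R g) - pprt (f - t *\<^sub>R g)"
    have "0 \<le> ?w"
      using g that by (simp add: scaleR_right_mono)
    have "f - s *\<^sub>R g = (f - t *\<^sub>R g) + (t - s) *\<^sub>R g" by (simp add: algebra_simps)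
    also have "\<dots> \<le> pprt (f - t *\<^sub>R g) + (t - s) *\<^sub>R g" by (simp add: pprt_def)
    finally have "pprt (f - s *\<^sub>R g) \<le> pprt (f - t *\<^sub>R g) + (t - s) *\<^sub>R g"
      using g that unfolding pprt_def[of "f - s *\<^sub>R g"]
      by (intro le_supI) (simp_all add: scaleR_nonneg_nonneg)
    then have "?w \<le> (t - s) *\<^sub>R g"
      by (simp add: algebra_simps)
    then have "S ?w \<le> (t - s) *\<^sub>R S g"
      using mono S by (metis linear_scale)
    moreover have "T ?w \<le> S ?w"
      using dom[OF \<open>0 \<le> ?w\<close>] abs_ge_self order_trans by blast
    ultimately have "T ?w \<le> (t - s) *\<^sub>R S g" by simp
    then show ?thesis by (simp add: d_def diff algebra_simps)
  qed
  have vG: "pprt (T f - e *\<^sub>R S g) * T g = 0" if e: "0 < e" for e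
  proof -
    \<comment> \<open>On the support of \<open>v\<close>, \<open>T f\<close> exceeds
      \<open>e *\<^sub>R S g\<close>, the most that \<open>d\<close> can drop over a step of length
      \<open>e\<close>.\<close>
    define v where "v = pprt (T f - e *\<^sub>R S g)"
    have v0: "0 \<le> v" by (simp add: v_def)
    have step: "v * d (real k * e) = v * (T f - (real k * e) *\<^sub>R T g)" for k
    proof (induction k)
      case 0
      then show ?case using f by (simp add: d_def)
    next
      case (Suc k)
      define t where "t = real (Suc k) * e"
      define R where "R = d t - (T f - t *\<^sub>R T g)"
      have "d (real k * e) - (t - real k * e) *\<^sub>R S g \<le> d t"
        using e by (intro d_cont) (simp add: t_def)
      then have "d (real k * e) - e *\<^sub>R S g \<le> d t"
        by (simp add: t_def algebra_simps)
      then have "v * (d (real k * e) - e *\<^sub>R S g) \<le> v * d t"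
        using v0 by (rule mult_left_mono)
      then have "v * (T f - (real k * e) *\<^sub>R T g - e *\<^sub>R S g) \<le> v * d t"
        using Suc by (simp add: right_diff_distrib)
      moreover have "v * (T f - e *\<^sub>R S g) \<le> v * (T f - (real k * e) *\<^sub>R T g - e *\<^sub>R S g)"
        using v0 G e by (intro mult_left_mono) (simp_all add: scaleR_nonneg_nonpos)
      moreover have "v * (T f - e *\<^sub>R S g) = v * v"
        by (simp add: v_def pprt_mult_self)
      \<comment> \<open>Thus \<open>d t\<close> is positive on the support of \<open>v\<close>, and
        \<open>d_mult\<close> leaves only \<open>R = 0\<close> there.\<close>
      ultimately have vv: "v * v \<le> v * d t" by simp
      then have vd: "0 \<le> v * d t" using v0 by (meson mult_nonneg_nonneg order_trans)
      have "v * v * \<bar>R\<bar> \<le> v * d t * \<bar>R\<bar>"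
        using vv by (intro mult_right_mono) auto
      also have "\<dots> = \<bar>v * (d t * R)\<bar>"
        using abs_mult_left[OF vd, of R] by (simp add: mult.assoc)
      also have "d t * R = 0"
        unfolding R_def by (rule d_mult)
      finally have "v * v * \<bar>R\<bar> = 0"
        using v0 by (intro order.antisym) simp_all
      then have "v * \<bar>R\<bar> = 0" by (rule mult_eq_0_of_square_mult)
      then have "v * R = 0" using abs_mult_left[OF v0, of R] by simp
      then show ?case by (simp add: R_def t_def right_diff_distrib)
    qed
    \<comment> \<open>By \<open>step\<close>, \<open>v * d\<close> is affine along the grid with
      slope \<open>v * (- T g)\<close>, yet it stays below \<open>v * S f\<close>.\<close>
    have "e *\<^sub>R (v * (- T g)) \<le> 0"
    proof (rule archimedean_le_0)
      fix k :: nat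
      have "real k *\<^sub>R (e *\<^sub>R (v * (- T g))) \<le> v * (T f - (real k * e) *\<^sub>R T g)"
        using v0 F by (simp add: right_diff_distrib)
      also have "\<dots> \<le> v * S f"
        using step[of k] d_bound[of "real k * e"] e v0 by (metis mult_left_mono mult_nonneg_nonneg of_nat_0_le_iff less_imp_le)
      finally show "real k *\<^sub>R (e *\<^sub>R (v * (- T g))) \<le> v * S f" .
    qed
    then have "(1 / e) *\<^sub>R (e *\<^sub>R (v * (- T g))) \<le> (1 / e) *\<^sub>R 0"
      using e by (intro scaleR_left_mono) auto
    then have "0 \<le> v * T g" using e by simp
    moreover have "v * T g \<le> 0" using v0 G by (simp add: mult_nonneg_nonpos)
    ultimately show ?thesis by (simp add: v_def)
  qed
  have "T f * (- T g) \<le> 0"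
  proof (rule le_0_of_le_scaleR)
    fix e :: real assume e: "0 < e"
    have "T f - e *\<^sub>R S g \<le> pprt (T f - e *\<^sub>R S g)" by (simp add: pprt_def)
    then have "(T f - e *\<^sub>R S g) * (- T g) \<le> pprt (T f - e *\<^sub>R S g) * (- T g)"
      using G by (intro mult_right_mono) auto
    then have "(T f - e *\<^sub>R S g) * (- T g) \<le> 0"
      using vG[OF e] by simp
    then show "T f * (- T g) \<le> e *\<^sub>R (S g * (- T g))"
      by (simp add: left_diff_distrib)
  qed
  moreover have "T f * T g \<le> 0" using F G by (rule mult_nonneg_nonpos)
  ultimately show ?thesis by simp
qed

text \<open>On the support of \<open>z\<close>, \<open>T f\<close> is positive and
  \<open>T g\<close> is negative. So \<open>z * T\<close> meets the hypotheses of the lemma on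
  opposite signs, and the product that this lemma annihilates is
  \<open>- (z * z * z)\<close>.\<close>

lemma pprt_mult_pprt_minus_eq_0:
  assumes "0 \<le> f" "0 \<le> g"
  shows "pprt (T f) * pprt (- T g) = 0"
proof -
  define z where "z = pprt (T f) * pprt (- T g)"
  have z0: "0 \<le> z" by (simp add: z_def)
  interpret z: regular_separating "\<lambda>x. z * T x"
    using z0 by (rule mult_left_op)
  have zf: "z * T f = (pprt (T f) * pprt (T f)) * pprt (- T g)"
    unfolding z_def by (metis mult.assoc mult.commute pprt_mult_self)
  have zg: "z * T g = - (pprt (T f) * (pprt (- T g) * pprt (- T g)))"
  proof -
    have "pprt (- T g) * T g = - (pprt (- T g) * pprt (- T g))"
      using pprt_mult_self[of "- T g"] by (metis minus_minus mult_minus_right)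
    then show ?thesis by (simp add: z_def mult.assoc)
  qed
  have "(z * T f) * (z * T g) = 0"
    using assms by (intro z.opposite_signs_mult_eq_0) (simp_all add: zf zg)
  moreover have "(z * T f) * (z * T g) = - (z * z * z)"
    by (simp only: zf zg) (simp add: z_def ac_simps)
  ultimately have "z * z * z = 0"
    by simp
  then show ?thesis
    using unital_cube_eq_0 by (simp add: z_def)
qed

lemma T_mult_parts:
  assumes "0 \<le> f" "0 \<le> g"
  shows "T f * T g = pprt (T f) * pprt (T g) + pprt (- T f) * pprt (- T g)"
proof -
  have "T f * T g = (pprt (T f) - pprt (- T f)) * (pprt (T g) - pprt (- T g))"
    by (simp add: pprt_diff_pprt_minus)
  then show ?thesis
    using pprt_mult_pprt_minus_eq_0[OF assms] pprt_mult_pprt_minus_eq_0[OF assms(2,1)]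
    by (simp add: algebra_simps)
qed

lemma mult_nonneg: "0 \<le> f \<Longrightarrow> 0 \<le> g \<Longrightarrow> 0 \<le> T f * T g"
  by (simp add: T_mult_parts)

end

section \<open>Moving a middle factor from one value of the operator to another\<close>

lemma eq_0_of_inf_mult_eq_0:
  fixes f h z :: "'a::semiprime_f_algebra"
  assumes f: "0 \<le> f" and h: "0 \<le> h" and z: "0 \<le> z" and d: "inf (h * z) (z * f) = 0"
    and zh: "\<And>w. inf h w = 0 \<Longrightarrow> inf z w = 0" and zf: "\<And>w. inf f w = 0 \<Longrightarrow> inf z w = 0"
  shows "z = 0"
proof -
  \<comment> \<open>The hypotheses \<open>zh\<close> and \<open>zf\<close> put \<open>z\<close> into
    the bands of \<open>h\<close> and \<open>f\<close>. They allow \<open>h\<close> and then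
    \<open>f\<close> to be traded for further factors \<open>z\<close>, until a fourth power is
    left.\<close>
  have "h * z * (z * f) = 0"
    using d by (rule mult_eq_0_of_inf_eq_0)
  then have "inf h (z * z * f) = 0"
    using z f h by (intro inf_eq_0_of_mult_eq_0) (simp_all add: mult.assoc)
  then have "z * (z * z * f) = 0"
    by (intro mult_eq_0_of_inf_eq_0 zh)
  then have "inf (z * z * z) f = 0"
    using z f by (intro inf_eq_0_of_mult_eq_0) (simp_all add: mult.assoc)
  then have "z * (z * z * z) = 0"
    by (intro mult_eq_0_of_inf_eq_0 zf) (simp add: inf_commute)
  then have "nilpotent z"
    by (auto simp: nilpotent_def numeral_eq_Suc mult.assoc intro!: exI[of _ 3])
  then show ?thesis by (rule semiprime)
qed

text \<open>Multiplying \<open>h * g - t *\<^sub>R h\<close> on the right by \<open>f\<close> and \<open>g * f - t *\<^sub>R f\<close> on the left by \<open>h\<close>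
  gives the same element, so no commutativity is needed here.\<close>

lemma inf_pprt_affine_eq_0:
  fixes f g h :: "'a::semiprime_f_algebra"
  assumes f: "0 \<le> f" and g: "0 \<le> g" and h: "0 \<le> h" and t: "0 \<le> t"
  shows "inf (pprt (h * g - t *\<^sub>R h)) (pprt (- (g * f - t *\<^sub>R f))) = 0" (is ?P)
    and "inf (pprt (- (h * g - t *\<^sub>R h))) (pprt (g * f - t *\<^sub>R f)) = 0" (is ?Q)
proof -
  have bounds: "pprt (u - t *\<^sub>R v) \<le> u" "pprt (- (u - t *\<^sub>R v)) \<le> t *\<^sub>R v"
    if "0 \<le> u" "0 \<le> v" for u v :: 'a
    using that t by (simp_all add: pprt_def scaleR_nonneg_nonneg)
  have scaled: "inf (t *\<^sub>R v) w = 0" if "inf v w = 0" for v w :: 'a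
  proof -
    have "0 \<le> v" "0 \<le> w" using that by (metis inf_le1 inf_le2)+
    then show ?thesis
      using mult_eq_0_of_inf_eq_0[OF that] t
      by (intro inf_eq_0_of_mult_eq_0) (simp_all add: scaleR_nonneg_nonneg)
  qed
  have below: "inf z w = 0" if "inf v w = 0" "0 \<le> z" "z \<le> v" for v w z :: 'a
  proof -
    have "0 \<le> w" using that(1) by (metis inf_le2)
    then show ?thesis using that by (intro inf_eq_0_mono[OF that(1)]) auto
  qed
  have xf: "pprt (h * g - t *\<^sub>R h) * f = pprt (h * g * f - t *\<^sub>R (h * f))"
    "pprt (- (h * g - t *\<^sub>R h)) * f = pprt (- (h * g * f - t *\<^sub>R (h * f)))"
    using f by (simp_all add: left_diff_distrib flip: pprt_mult_right)
  have hy: "h * pprt (g * f - t *\<^sub>R f) = pprt (h * g * f - t *\<^sub>R (h * f))"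
    "h * pprt (- (g * f - t *\<^sub>R f)) = pprt (- (h * g * f - t *\<^sub>R (h * f)))"
    using h by (simp_all add: right_diff_distrib mult.assoc flip: pprt_mult_left)
  have d: "inf (h * inf x y) (inf x y * f) = 0"
    if "inf (h * y) (x * f) = 0" "0 \<le> x" "0 \<le> y" for x y
    using that f h by (intro inf_eq_0_mono[OF that(1)] mult_left_mono mult_right_mono) auto
  show ?P
  proof (rule eq_0_of_inf_mult_eq_0[OF f h])
    let ?z = "inf (pprt (h * g - t *\<^sub>R h)) (pprt (- (g * f - t *\<^sub>R f)))"
    show z: "0 \<le> ?z" by simp
    show "inf (h * ?z) (?z * f) = 0"
      by (rule d) (simp_all only: xf hy inf_pprt_pprt_minus inf_commute zero_le_pprt)
    \<comment> \<open>The two bounds of \<open>?z\<close> place it in the required bands: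
      \<open>h * g\<close> lies in that of \<open>h\<close>, and \<open>t *\<^sub>R f\<close> in
      that of \<open>f\<close>.\<close>
    have "?z \<le> h * g" using bounds(1)[of "h * g" h] g h by (simp add: le_infI1)
    then show "inf ?z w = 0" if "inf h w = 0" for w
      by (rule below[OF f_mult_right[OF that g] z])
    have "?z \<le> t *\<^sub>R f" using bounds(2)[of "g * f" f] g f by (simp add: le_infI2)
    then show "inf ?z w = 0" if "inf f w = 0" for w
      by (rule below[OF scaled[OF that] z])
  qed
  show ?Q
  proof (rule eq_0_of_inf_mult_eq_0[OF f h])
    let ?z = "inf (pprt (- (h * g - t *\<^sub>R h))) (pprt (g * f - t *\<^sub>R f))"
    show z: "0 \<le> ?z" by simp
    show "inf (h * ?z) (?z * f) = 0"
      by (rule d) (simp_all only: xf hy inf_pprt_pprt_minus zero_le_pprt)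
    have "?z \<le> t *\<^sub>R h" using bounds(2)[of "h * g" h] g h by (simp add: le_infI1)
    then show "inf ?z w = 0" if "inf h w = 0" for w
      by (rule below[OF scaled[OF that] z])
    have "?z \<le> g * f" using bounds(1)[of "g * f" f] g f by (simp add: le_infI2)
    then show "inf ?z w = 0" if "inf f w = 0" for w
      by (rule below[OF f_mult_left[OF that g] z])
  qed
qed

context regular_separating
begin

lemma mult_right_eq_mult_left_nonneg:
  assumes f: "0 \<le> f" and g: "0 \<le> g" and h: "0 \<le> h"
  shows "T (h * g) * T f = T h * T (g * f)"
proof -
  have "T (g * f) * T h = T f * T (h * g)"
  proof (rule mult_eq_of_affine_products_nonneg)
    fix t :: real assume t: "0 \<le> t"
    let ?x = "h * g - t *\<^sub>R h" and ?y = "g * f - t *\<^sub>R f"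
    \<comment> \<open>Opposite parts of \<open>?x\<close> and \<open>?y\<close> are disjoint, so
      only products of parts of equal sign survive, and these are nonnegative.\<close>
    have 1: "T (pprt ?x) * T (pprt (- ?y)) = 0"
      using inf_pprt_affine_eq_0(1)[OF f g h t] by (intro mult_eq_0 mult_eq_0_of_inf_eq_0)
    have 2: "T (pprt (- ?x)) * T (pprt ?y) = 0"
      using inf_pprt_affine_eq_0(2)[OF f g h t] by (intro mult_eq_0 mult_eq_0_of_inf_eq_0)
    have "(T (h * g) - t *\<^sub>R T h) * (T (g * f) - t *\<^sub>R T f) = T ?x * T ?y"
      by (simp add: diff scale)
    also have "\<dots> = T (pprt ?x - pprt (- ?x)) * T (pprt ?y - pprt (- ?y))"
      by (simp only: pprt_diff_pprt_minus)
    also have "\<dots> = T (pprt ?x) * T (pprt ?y) + T (pprt (- ?x)) * T (pprt (- ?y))"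
      using 1 2 by (simp add: diff left_diff_distrib right_diff_distrib)
    also have "0 \<le> \<dots>"
      by (intro add_nonneg_nonneg mult_nonneg) simp_all
    finally show "0 \<le> (T (h * g) - t *\<^sub>R T h) * (T (g * f) - t *\<^sub>R T f)" .
  qed (use f g h in \<open>simp_all add: mult_nonneg\<close>)
  then show ?thesis by (simp add: mult.commute)
qed

text \<open>Both sides are trilinear in \<open>f\<close>, \<open>g\<close>, \<open>h\<close>, so the
  identity extends from positive elements to their differences.\<close>

lemma mult_right_eq_mult_left: "T (h * g) * T f = T h * T (g * f)"
proof -
  have *: "T ((h1 - h2) * (g1 - g2)) * T (f1 - f2) = T (h1 - h2) * T ((g1 - g2) * (f1 - f2))"
    if "0 \<le> f1" "0 \<le> f2" "0 \<le> g1" "0 \<le> g2" "0 \<le> h1" "0 \<le> h2" for f1 f2 g1 g2 h1 h2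
    using that by (simp add: left_diff_distrib right_diff_distrib diff mult_right_eq_mult_left_nonneg)
  from *[of "pprt f" "pprt (- f)" "pprt g" "pprt (- g)" "pprt h" "pprt (- h)"]
  show ?thesis by (simp add: pprt_diff_pprt_minus)
qed

end


section \<open>The composition factor\<close>

context regular_separating
begin

text \<open>The range of \<open>T\<close> may generate an ideal that is not dense; these elements
  complete it to a dense one.\<close>

definition annihilator :: "'e set" where
  "annihilator = {z. \<forall>h. z * T h = 0}"

lemma annihilatorD: "z \<in> annihilator \<Longrightarrow> z * T h = 0" "z \<in> annihilator \<Longrightarrow> T h * z = 0"
  by (simp_all add: annihilator_def mult.commute)

text \<open>An element that kills \<open>D\<close> kills the range of \<open>T\<close>, so it lies
  in \<open>annihilator\<close>, hence in \<open>D\<close>, and its own square is 0.\<close>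

lemma dense_idealI:
  assumes "\<And>x y. x \<in> D \<Longrightarrow> y \<in> D \<Longrightarrow> x + y \<in> D" "\<And>r x. x \<in> D \<Longrightarrow> r * x \<in> D"
    and T: "\<And>g. T g \<in> D" and ann: "annihilator \<subseteq> D"
  shows "dense_ideal D"
  unfolding dense_ideal_def
proof (intro conjI ballI allI impI)
  show "0 \<in> D" using T[of 0] by (simp add: zero)
  fix r assume r: "\<forall>x\<in>D. r * x = 0"
  then have "r \<in> annihilator" using T by (simp add: annihilator_def)
  then have "r * r = 0" using r ann by auto
  then show "r = 0" by (rule unital_square_eq_0)
qed (use assms in auto)

text \<open>Up to the embedding, this product will be \<open>C f\<close> times the square of
  \<open>T g\<close>, the form in which the sign of \<open>C f\<close> is tested. Separation removes
  the mixed terms of the parts of \<open>g\<close>.\<close>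

lemma mult_self_nonneg:
  assumes f: "0 \<le> f"
  shows "0 \<le> T (g * f) * T g"
proof -
  let ?p = "pprt g" and ?n = "pprt (- g)"
  have "(?p * f) * ?n = 0"
    using f_mult_right[OF inf_pprt_pprt_minus[of g] f] by (rule mult_eq_0_of_inf_eq_0)
  moreover have "(?n * f) * ?p = 0"
    using f_mult_right[OF inf_pprt_pprt_minus[of "- g"] f]
    by (intro mult_eq_0_of_inf_eq_0) simp
  ultimately have cross: "T (?p * f) * T ?n = 0" "T (?n * f) * T ?p = 0"
    by (auto intro: mult_eq_0)
  have "T (g * f) * T g = T ((?p - ?n) * f) * T (?p - ?n)"
    by (simp only: pprt_diff_pprt_minus)
  also have "\<dots> = T (?p * f) * T ?p + T (?n * f) * T ?n"
    using cross by (simp add: left_diff_distrib right_diff_distrib diff)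
  also have "0 \<le> \<dots>"
    using f by (intro add_nonneg_nonneg mult_nonneg) simp_all
  finally show ?thesis .
qed

end

locale separating_quotient = regular_separating T
  for T :: "'a::semiprime_f_algebra \<Rightarrow> 'e::unital_f_algebra" +
  fixes j :: "'e \<Rightarrow> 'q::unital_f_algebra"
  assumes quot: "maximal_quotient_f_algebra j"
begin

lemma j_linear: "linear j" and j_inj: "inj j" and j_mult: "j (x * y) = j x * j y"
  and j_sup: "j (sup x y) = sup (j x) (j y)"
  using quot by (simp_all add: maximal_quotient_f_algebra_def f_algebra_embedding_def
      maximal_quotient_ring_def)

lemma j_add: "j (x + y) = j x + j y" and j_diff: "j (x - y) = j x - j y"
  and j_scale: "j (r *\<^sub>R x) = r *\<^sub>R j x" and j_0: "j 0 = 0" and j_neg: "j (- x) = - j x"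
  using j_linear by (simp_all add: linear_add linear_diff linear_scale linear_0 linear_neg)

lemma j_le_iff: "j x \<le> j y \<longleftrightarrow> x \<le> y"
  by (metis j_inj j_sup injD le_iff_sup)

lemma fraction_multiplier: "fraction D \<phi> \<Longrightarrow> \<exists>!q. \<forall>x\<in>D. q * j x = j (\<phi> x)"
  using quot by (auto simp: maximal_quotient_f_algebra_def maximal_quotient_ring_def)

text \<open>The elements killed by \<open>q - q'\<close> form a dense ideal, on which
  \<open>q - q'\<close> and 0 both represent the zero fraction.\<close>

lemma quotient_eqI:
  assumes T: "\<And>g. q * j (T g) = q' * j (T g)" and z: "\<And>z. z \<in> annihilator \<Longrightarrow> q * j z = q' * j z"
  shows "q = q'"
proof -
  define D where "D = {x. (q - q') * j x = 0}"
  have "dense_ideal D"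
  proof (rule dense_idealI)
    show "r * x \<in> D" if "x \<in> D" for r x
      using that by (simp add: D_def j_mult mult.left_commute[of "q - q'"])
  qed (use T z in \<open>auto simp: D_def j_add distrib_left left_diff_distrib\<close>)
  then have "fraction D (\<lambda>_. 0)" by (simp add: fraction_def)
  then have "\<exists>!p. \<forall>x\<in>D. p * j x = j 0" by (rule fraction_multiplier)
  moreover have "\<forall>x\<in>D. (q - q') * j x = j 0" "\<forall>x\<in>D. 0 * j x = j 0"
    by (simp_all add: D_def j_0)
  ultimately have "q - q' = 0" by blast
  then show ?thesis by simp
qed

lemma exists_composition_factor:
  "\<exists>c. (\<forall>g. c * j (T g) = j (T (g * f))) \<and> (\<forall>z\<in>annihilator. c * j z = 0)"
proof -
  \<comment> \<open>The relation says that the fraction sends \<open>x\<close> to \<open>y\<close>.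
    It is stated through products and does not refer to a representation of \<open>x\<close> by
    values of \<open>T\<close>, so well-definedness becomes uniqueness of \<open>y\<close>.\<close>
  define P where "P x y \<longleftrightarrow> (\<forall>h. y * T h = x * T (f * h)) \<and> (\<forall>z\<in>annihilator. y * z = 0)" for x y
  define D where "D = {x. \<exists>y. P x y}"
  define \<phi> where "\<phi> x = (THE y. P x y)" for x
  have unique: "y = y'" if "P x y" "P x y'" for x y y'
  proof -
    \<comment> \<open>The difference both lies in the annihilator and kills it, so its square is
      0.\<close>
    have "y - y' \<in> annihilator"
      using that by (simp add: P_def annihilator_def left_diff_distrib)
    then have "(y - y') * (y - y') = 0"
      using that unfolding P_def by (simp only: left_diff_distrib) simp
    then show ?thesis using unital_square_eq_0[of "y - y'"] by simp
  qed
  have \<phi>_eq: "\<phi> x = y" if "P x y" for x y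
    unfolding \<phi>_def using that unique by blast
  have P_add: "P (x + x') (y + y')" if "P x y" "P x' y'" for x x' y y'
    using that by (simp add: P_def distrib_right)
  have P_mult: "P (r * x) (r * y)" if "P x y" for r x y
    using that by (simp add: P_def mult.assoc)
  have P_T: "P (T g) (T (g * f))" for g
    by (simp add: P_def mult_right_eq_mult_left annihilatorD)
  have P_ann: "P z 0" if "z \<in> annihilator" for z
    using that by (simp add: P_def annihilatorD)
  have "dense_ideal D"
    by (rule dense_idealI; unfold D_def subset_iff mem_Collect_eq)
      (use P_add P_mult P_T P_ann in blast)+
  then have "fraction D \<phi>"
    unfolding fraction_def D_def using P_add P_mult by (auto simp: \<phi>_eq)
  then obtain c where c: "\<And>x. x \<in> D \<Longrightarrow> c * j x = j (\<phi> x)"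
    using fraction_multiplier by blast
  have "c * j x = j y" if "P x y" for x y
    using that c[of x] \<phi>_eq by (auto simp: D_def)
  then show ?thesis
    using P_T P_ann j_0 by metis
qed

text \<open>By \<open>quotient_eqI\<close> the two conditions determine \<open>c\<close>. The second
  one makes \<open>C f\<close> vanish where \<open>T\<close> vanishes.\<close>

definition C :: "'a \<Rightarrow> 'q" where
  "C f = (SOME c. (\<forall>g. c * j (T g) = j (T (g * f))) \<and> (\<forall>z\<in>annihilator. c * j z = 0))"

lemma C_mult_T: "C f * j (T g) = j (T (g * f))"
  and C_mult_annihilator: "z \<in> annihilator \<Longrightarrow> C f * j z = 0"
  using someI_ex[OF exists_composition_factor[of f]] by (auto simp: C_def)

lemma C_linear: "linear C"
proof (rule linearI)
  show "C (x + y) = C x + C y" for x y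
    by (rule quotient_eqI)
      (simp_all add: distrib_right distrib_left C_mult_T C_mult_annihilator add j_add)
  show "C (r *\<^sub>R x) = r *\<^sub>R C x" for r x
    by (rule quotient_eqI) (simp_all add: C_mult_T C_mult_annihilator scale j_scale)
qed

lemma C_mult: "C (f * g) = C f * C g"
proof (rule quotient_eqI)
  show "C (f * g) * j (T h) = C f * C g * j (T h)" for h
  proof -
    have "C f * C g * j (T h) = C g * (C f * j (T h))"
      by (simp only: ac_simps)
    then show ?thesis by (simp only: C_mult_T mult.assoc)
  qed
  show "C (f * g) * j z = C f * C g * j z" if "z \<in> annihilator" for z
    using that by (simp add: C_mult_annihilator mult.assoc)
qed

text \<open>The negative part of \<open>C f\<close> kills every \<open>x\<close> with
  \<open>0 \<le> C f * x * x\<close>. These include the values of \<open>T\<close> and the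
  annihilator, which together detect 0.\<close>

lemma C_nonneg:
  assumes f: "0 \<le> f"
  shows "0 \<le> C f"
proof -
  have *: "pprt (- C f) * x = 0" if "0 \<le> C f * x * x" for x
  proof -
    have "x * x * (- C f) \<le> 0"
      using that by (simp add: ac_simps)
    then have "x * x * pprt (- C f) = 0"
      by (simp only: pprt_eq_0 flip: pprt_mult_left[OF square_nonneg])
    then show ?thesis
      using mult_eq_0_of_square_mult[of x "pprt (- C f)"] by (simp only: mult.commute)
  qed
  have "pprt (- C f) = 0"
  proof (rule quotient_eqI)
    fix g
    have "0 \<le> j (T (g * f) * T g)"
      using mult_self_nonneg[OF f] j_le_iff[of 0] by (simp add: j_0)
    then show "pprt (- C f) * j (T g) = 0 * j (T g)"
      by (simp add: * C_mult_T j_mult)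
  qed (simp add: * C_mult_annihilator)
  then show ?thesis by (simp flip: le_zero_iff_zero_pprt)
qed

lemma C_composition: "C \<in> composition_ops"
proof -
  have "positive_op C" "positive_op (\<lambda>_::'a. 0::'q)"
    using C_linear C_nonneg by (auto simp: positive_op_def linear_iff)
  then show ?thesis
    unfolding composition_ops_def regular_op_def mem_Collect_eq
    by (intro conjI exI[of _ C] exI[of _ "\<lambda>_. 0"]) (simp_all add: C_mult)
qed

end


section \<open>The multiplier\<close>

lemma unital_one_nonneg: "0 \<le> (1::'a::unital_f_algebra)"
  using square_nonneg[of "1::'a"] by simp

lemma mult_pprt_two_minus_le_one:
  fixes y :: "'a::unital_f_algebra"
  assumes "0 \<le> y"
  shows "y * pprt (1 + 1 - y) \<le> 1"
proof -
  have "y * (1 + 1 - y) = 1 - (1 - y) * (1 - y)"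
    by (simp add: algebra_simps)
  also have "\<dots> \<le> 1" by (simp add: square_nonneg)
  finally have "pprt (y * (1 + 1 - y)) \<le> 1"
    using unital_one_nonneg by (simp add: pprt_def)
  then show ?thesis by (simp add: pprt_mult_left assms)
qed

text \<open>An excess \<open>r\<close> of \<open>Sup S * x\<close> over \<open>m\<close>, scaled by
  \<open>t\<close> and truncated by \<open>w\<close>, could be subtracted from \<open>Sup S\<close>
  and leave an upper bound of \<open>S\<close>. The factor \<open>t *\<^sub>R w\<close> stands in
  for an inverse of \<open>x\<close>; letting \<open>t\<close> tend to 0 removes the
  truncation.\<close>

lemma cSup_mult_le:
  fixes S :: "'e::{unital_f_algebra, conditionally_complete_lattice} set"
  assumes ne: "S \<noteq> {}" and bdd: "bdd_above S" and x: "0 \<le> x"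
    and le: "\<And>s. s \<in> S \<Longrightarrow> s * x \<le> m"
  shows "Sup S * x \<le> m"
proof -
  define r where "r = pprt (Sup S * x - m)"
  have r0: "0 \<le> r" by (simp add: r_def)
  have "r + r \<le> 0"
  proof (rule le_0_of_le_scaleR)
    fix t :: real assume t: "0 < t"
    define w where "w = pprt (1 + 1 - t *\<^sub>R x)"
    have w0: "0 \<le> w" by (simp add: w_def)
    have tx: "t *\<^sub>R x * w \<le> 1"
      unfolding w_def using t x by (intro mult_pprt_two_minus_le_one scaleR_nonneg_nonneg) auto
    have "s \<le> Sup S - t *\<^sub>R (r * w)" if s: "s \<in> S" for s
    proof -
      have ss: "s \<le> Sup S" using s bdd by (rule cSup_upper)
      have "Sup S * x - m \<le> Sup S * x - s * x" using le[OF s] by simp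
      also have "\<dots> = (Sup S - s) * x" by (simp add: left_diff_distrib)
      finally have "r \<le> (Sup S - s) * x"
        using ss x by (simp add: r_def pprt_def)
      then have "t *\<^sub>R (r * w) \<le> t *\<^sub>R ((Sup S - s) * x * w)"
        using w0 t by (intro scaleR_left_mono mult_right_mono) auto
      also have "\<dots> = (Sup S - s) * (t *\<^sub>R x * w)" by (simp add: mult.assoc)
      also have "\<dots> \<le> (Sup S - s) * 1"
        using ss tx by (intro mult_left_mono) auto
      finally show ?thesis by (simp add: algebra_simps)
    qed
    then have "Sup S \<le> Sup S - t *\<^sub>R (r * w)" using ne by (intro cSup_least)
    then have "t *\<^sub>R (r * w) \<le> 0" by simp
    then have "(1 / t) *\<^sub>R (t *\<^sub>R (r * w)) \<le> (1 / t) *\<^sub>R 0"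
      using t by (intro scaleR_left_mono) auto
    then have "r * w \<le> 0" using t by simp
    moreover have "r * (1 + 1 - t *\<^sub>R x) \<le> r * w"
      using r0 by (intro mult_left_mono) (simp_all add: w_def pprt_def)
    ultimately have "r * (1 + 1 - t *\<^sub>R x) \<le> 0" by simp
    then show "r + r \<le> t *\<^sub>R (r * x)" by (simp add: algebra_simps)
  qed
  then have "r = 0" using r0 by simp
  then have "pprt (Sup S * x - m) = 0" by (simp add: r_def)
  then show ?thesis by (simp flip: le_zero_iff_zero_pprt)
qed

text \<open>Formally \<open>2 * g - g\<^sup>2 = 1 - (1 - g)\<^sup>2\<close>, so this truncation lies below the identity.\<close>

lemma pprt_quadratic_in_unit_interval:
  fixes g :: "'a::semiprime_f_algebra"
  assumes g: "0 \<le> g"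
  shows "pprt (g + g - g * g) \<in> unit_interval"
proof -
  have "(g + g - g * g) * x \<le> x" if x: "0 \<le> x" for x
  proof -
    define z where "z = x - (g + g - g * g) * x"
    \<comment> \<open>Formally \<open>?X * ?Y\<close> is \<open>x * (1 - g)^2 * x\<close>.\<close>
    let ?X = "x * g - x" and ?Y = "g * x - x"
    have "inf (pprt ?X) (pprt (- ?Y)) = 0" "inf (pprt (- ?X)) (pprt ?Y) = 0"
      using inf_pprt_affine_eq_0[OF x g x, of 1] by simp_all
    then have cross: "pprt ?X * pprt (- ?Y) = 0" "pprt (- ?X) * pprt ?Y = 0"
      by (simp_all only: mult_eq_0_of_inf_eq_0)
    have "x * z = ?X * ?Y"
      by (simp add: z_def algebra_simps)
    also have "\<dots> = (pprt ?X - pprt (- ?X)) * (pprt ?Y - pprt (- ?Y))"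
      by (simp only: pprt_diff_pprt_minus)
    also have "\<dots> = pprt ?X * pprt ?Y + pprt (- ?X) * pprt (- ?Y)"
      using cross by (simp only: left_diff_distrib right_diff_distrib) simp
    finally have "0 \<le> x * z" by simp
    then have "x * pprt (- z) = 0"
      using pprt_mult_left[OF x, of "- z"] by simp
    \<comment> \<open>The sign of \<open>x * z\<close> shows only that the negative part of
      \<open>z\<close> is disjoint from \<open>x\<close>. That part also lies below
      \<open>(g + g) * x\<close>, hence in the band of \<open>x\<close>, so it is 0.\<close>
    then have "inf x (pprt (- z)) = 0"
      using x by (intro inf_eq_0_of_mult_eq_0) simp_all
    then have disj: "inf ((g + g) * x) (pprt (- z)) = 0"
      using g by (intro f_mult_left) simp_all
    have z_eq: "- z = (g + g) * x - (g * g * x + x)"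
      by (simp add: z_def algebra_simps)
    have "pprt (- z) \<le> (g + g) * x"
    proof -
      have "0 \<le> g * g * x + x" using g x by simp
      then have "(g + g) * x - (g * g * x + x) \<le> (g + g) * x"
        by (simp only: diff_le_eq le_add_same_cancel1)
      then show ?thesis
        using z_eq g x by (simp only: pprt_def) (simp add: le_supI)
    qed
    then have "pprt (- z) = 0"
      using disj by (simp add: inf_absorb2)
    then show ?thesis by (simp add: z_def flip: le_zero_iff_zero_pprt)
  qed
  then show ?thesis
    by (auto simp: unit_interval_def op_le_def mult_op_def simp flip: pprt_mult_right)
       (simp add: pprt_def)
qed

section \<open>The multiplier as a difference of two suprema\<close>

locale almost_contractive_quotient = separating_quotient T j
  for T :: "'a::semiprime_f_algebra \<Rightarrow> 'e::{unital_f_algebra, conditionally_complete_lattice}"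
    and j :: "'e \<Rightarrow> 'q::unital_f_algebra" +
  fixes \<pi> :: 'e
  assumes contractive: "u \<in> unit_interval \<Longrightarrow> \<bar>T u\<bar> \<le> \<pi>"
begin

text \<open>On positive elements \<open>T\<close> keeps one sign at each point of a representation.
  At most one of the two suprema is nonzero there, and \<open>\<omega>\<close> carries the sign of
  \<open>T\<close>.\<close>

definition \<omega>pos :: 'e where "\<omega>pos = Sup ((\<lambda>u. pprt (T u)) ` unit_interval)"
definition \<omega>neg :: 'e where "\<omega>neg = Sup ((\<lambda>u. pprt (- T u)) ` unit_interval)"
definition \<omega> :: 'e where "\<omega> = \<omega>pos - \<omega>neg"

lemma zero_in_unit_interval: "0 \<in> (unit_interval :: 'a set)"
  by (simp add: unit_interval_def op_le_def mult_op_def)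

lemma pprt_T_le: "u \<in> unit_interval \<Longrightarrow> pprt (T u) \<le> \<pi>" "u \<in> unit_interval \<Longrightarrow> pprt (- T u) \<le> \<pi>"
  using contractive[of u] zero_le_pprt[of "T u"] zero_le_pprt[of "- T u"]
  by (auto simp: abs_eq_pprt_add intro: order_trans[rotated])

lemma bdd_parts:
  "bdd_above ((\<lambda>u. pprt (T u)) ` unit_interval)" "bdd_above ((\<lambda>u. pprt (- T u)) ` unit_interval)"
  using pprt_T_le by (auto intro!: bdd_aboveI[where M = \<pi>])

lemma pprt_T_le_\<omega>:
  assumes "u \<in> unit_interval"
  shows "pprt (T u) \<le> \<omega>pos" "pprt (- T u) \<le> \<omega>neg"
  unfolding \<omega>pos_def \<omega>neg_def using assms bdd_parts by (auto intro: cSup_upper)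

lemma \<omega>_parts_mult_le:
  assumes "0 \<le> x"
  shows "(\<And>u. u \<in> unit_interval \<Longrightarrow> pprt (T u) * x \<le> m) \<Longrightarrow> \<omega>pos * x \<le> m"
    and "(\<And>u. u \<in> unit_interval \<Longrightarrow> pprt (- T u) * x \<le> m) \<Longrightarrow> \<omega>neg * x \<le> m"
  unfolding \<omega>pos_def \<omega>neg_def using assms bdd_parts zero_in_unit_interval
  by (auto intro!: cSup_mult_le)

lemma \<omega>_parts_nonneg: "0 \<le> \<omega>pos" "0 \<le> \<omega>neg"
  using pprt_T_le_\<omega>[OF zero_in_unit_interval] by (simp_all add: zero)

text \<open>Since \<open>g - u * g\<close> is positive, its image has a nonnegative product with
  \<open>T h\<close>. Moving the middle factor turns \<open>T (u * g) * T h\<close> into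
  \<open>T u * T (g * h)\<close>.\<close>

lemma unit_interval_mult_le:
  assumes u: "u \<in> unit_interval" and g: "0 \<le> g" and h: "0 \<le> h"
  shows "T u * T (g * h) \<le> T g * T h"
proof -
  have "0 \<le> T (g - u * g) * T h"
    using u g h by (intro mult_nonneg) (simp_all add: unit_interval_def op_le_def mult_op_def)
  then show ?thesis
    using mult_right_eq_mult_left[of u g h] by (simp add: diff left_diff_distrib)
qed

lemma unit_interval_nonneg: "u \<in> unit_interval \<Longrightarrow> 0 \<le> u"
  by (simp add: unit_interval_def)

lemma \<omega>_mult:
  assumes g: "0 \<le> g"
  shows "\<omega> * T g = \<omega>pos * pprt (T g) + \<omega>neg * pprt (- T g)"
proof -
  \<comment> \<open>The values \<open>T u\<close> and \<open>T g\<close> never have opposite signs,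
    which passes to the suprema over \<open>u\<close>.\<close>
  have "\<omega>pos * pprt (- T g) \<le> 0" "\<omega>neg * pprt (T g) \<le> 0"
    using pprt_mult_pprt_minus_eq_0[OF unit_interval_nonneg g]
      pprt_mult_pprt_minus_eq_0[OF g unit_interval_nonneg]
    by (auto intro!: \<omega>_parts_mult_le simp: mult.commute)
  then have z: "\<omega>pos * pprt (- T g) = 0" "\<omega>neg * pprt (T g) = 0"
    using \<omega>_parts_nonneg by (auto intro!: order.antisym)
  have "\<omega> * T g = (\<omega>pos - \<omega>neg) * (pprt (T g) - pprt (- T g))"
    by (simp add: pprt_diff_pprt_minus \<omega>_def)
  then show ?thesis
    using z by (simp add: algebra_simps)
qed

lemma unit_interval_le_\<omega>:
  assumes u: "u \<in> unit_interval" and g: "0 \<le> g"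
  shows "T u * T g \<le> \<omega> * T g"
  unfolding T_mult_parts[OF unit_interval_nonneg[OF u] g] \<omega>_mult[OF g]
  using pprt_T_le_\<omega>[OF u] by (intro add_mono mult_right_mono) simp_all

text \<open>Each sign is bounded separately when passing to the supremum. The two products are
  disjoint, so their sum is their supremum and obeys the same bound.\<close>

lemma \<omega>_mult_le:
  assumes g: "0 \<le> g" and h: "0 \<le> h"
  shows "\<omega> * T (g * h) \<le> T g * T h"
proof -
  let ?X = "T (g * h)"
  have gh: "0 \<le> g * h" using g h by simp
  let ?p = "\<omega>pos * pprt ?X" and ?n = "\<omega>neg * pprt (- ?X)"
  have le: "pprt (T u) * pprt ?X + pprt (- T u) * pprt (- ?X) \<le> T g * T h" if "u \<in> unit_interval" for u
    using unit_interval_mult_le[OF that g h] T_mult_parts[OF unit_interval_nonneg[OF that] gh] by simp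
  have "?p \<le> T g * T h" "?n \<le> T g * T h"
    by (intro \<omega>_parts_mult_le; use le in \<open>force intro: order_trans[rotated]\<close>)+
  moreover have "inf ?p ?n = 0"
    using \<omega>_parts_nonneg inf_pprt_pprt_minus[of ?X]
    by (metis f_mult_left inf_commute)
  ultimately show ?thesis
    using add_eq_inf_sup[of ?p ?n] by (simp add: \<omega>_mult[OF gh])
qed

lemma \<omega>_mult_ge:
  assumes g: "0 \<le> g" and h: "0 \<le> h"
  shows "T g * T h \<le> \<omega> * T (g * h)"
proof -
  define \<gamma> where "\<gamma> = C g"
  define K where "K = j (T g * T h)"
  define Y where "Y = j (\<omega> * T (g * h))"
  define M where "M = j (\<pi> * \<bar>T h\<bar>)"
  define D where "D = pprt (K - Y)"
  have gh: "0 \<le> g * h" using g h by simp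
  have j_nonneg: "0 \<le> j x" if "0 \<le> x" for x
    using that j_le_iff[of 0 x] by (simp add: j_0)
  have \<gamma>0: "0 \<le> \<gamma>" using g by (simp add: \<gamma>_def C_nonneg)
  have K0: "0 \<le> K" using g h by (simp add: K_def j_nonneg mult_nonneg)
  have Y0: "0 \<le> Y"
    using unit_interval_le_\<omega>[OF zero_in_unit_interval gh] by (simp add: Y_def j_nonneg zero)
  have D0: "0 \<le> D" by (simp add: D_def)
  have DK: "D \<le> K" using K0 Y0 by (simp add: D_def pprt_def)
  \<comment> \<open>Both bounds test the truncation \<open>u\<close> in the unit interval: the first
    compares \<open>T u\<close> with \<open>\<omega>\<close>, the second uses almost contractivity.
    Replacing \<open>u\<close> by the untruncated polynomial only lowers the products.\<close>
  have approx: "K * (a *\<^sub>R (\<gamma> + \<gamma>) - (a * a) *\<^sub>R (\<gamma> * \<gamma>)) \<le> Y"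
    "a *\<^sub>R (K + K) - (a * a) *\<^sub>R (\<gamma> * K) \<le> M" if a: "0 \<le> a" for a
  proof -
    define G where "G = a *\<^sub>R g"
    define u where "u = pprt (G + G - G * G)"
    define q where "q = pprt (- (G + G - G * G))"
    have G0: "0 \<le> G" using a g by (simp add: G_def scaleR_nonneg_nonneg)
    have u: "u \<in> unit_interval" unfolding u_def using G0 by (rule pprt_quadratic_in_unit_interval)
    have q0: "0 \<le> q" by (simp add: q_def)
    have uq: "u = G + G - G * G + q"
      using pprt_diff_pprt_minus[of "G + G - G * G"] by (simp add: u_def q_def algebra_simps)
    have jT: "j (T (g * g)) = \<gamma> * j (T g)" "j (T (g * g * g)) = \<gamma> * (\<gamma> * j (T g))"
      unfolding \<gamma>_def by (simp_all only: C_mult_T)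
    have "T ((G + G - G * G) * g) * T h \<le> T (u * g) * T h"
      using mult_nonneg[of "q * g" h] q0 g h
      by (simp add: uq distrib_right[of _ q] add[of _ "q * g"] distrib_right[of "T _" "T (q * g)"])
    also have "\<dots> = T u * T (g * h)" by (rule mult_right_eq_mult_left)
    also have "\<dots> \<le> \<omega> * T (g * h)" using u gh by (rule unit_interval_le_\<omega>)
    finally have "j (T ((G + G - G * G) * g) * T h) \<le> Y"
      by (simp add: Y_def j_le_iff)
    moreover have "(G + G - G * G) * g = a *\<^sub>R (g * g) + a *\<^sub>R (g * g) - (a * a) *\<^sub>R (g * g * g)"
      by (simp add: G_def algebra_simps)
    ultimately have "j (T (a *\<^sub>R (g * g) + a *\<^sub>R (g * g) - (a * a) *\<^sub>R (g * g * g)) * T h) \<le> Y"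
      by (simp only:)
    then show "K * (a *\<^sub>R (\<gamma> + \<gamma>) - (a * a) *\<^sub>R (\<gamma> * \<gamma>)) \<le> Y"
      unfolding K_def j_mult diff add scale j_diff j_add j_scale jT
      by (simp add: algebra_simps)
    have "T (G + G - G * G) * T h \<le> T u * T h"
      using mult_nonneg[OF q0 h] by (simp add: uq add[of _ q] distrib_right)
    also have "\<dots> \<le> \<bar>T u\<bar> * \<bar>T h\<bar>"
      by (metis abs_ge_self f_abs_mult)
    also have "\<dots> \<le> \<pi> * \<bar>T h\<bar>"
      using contractive[OF u] by (rule mult_right_mono) simp
    finally have "j (T (G + G - G * G) * T h) \<le> M"
      by (simp add: M_def j_le_iff)
    moreover have "G + G - G * G = a *\<^sub>R g + a *\<^sub>R g - (a * a) *\<^sub>R (g * g)"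
      by (simp add: G_def algebra_simps)
    ultimately have "j (T (a *\<^sub>R g + a *\<^sub>R g - (a * a) *\<^sub>R (g * g)) * T h) \<le> M"
      by (simp only:)
    then show "a *\<^sub>R (K + K) - (a * a) *\<^sub>R (\<gamma> * K) \<le> M"
      unfolding K_def j_mult diff add scale j_diff j_add j_scale jT
      by (simp add: algebra_simps)
  qed
  \<comment> \<open>Where \<open>\<gamma>\<close> is positive, \<open>a *\<^sub>R \<gamma>\<close>
    can be brought near 1, which leaves no room for the defect \<open>D\<close>. This is the gap
    argument with \<open>b = 1\<close>.\<close>
  have "D * \<gamma> = 0"
  proof (rule mult_eq_0_of_le_square[OF \<gamma>0 unital_one_nonneg D0 K0])
    fix a :: real assume a: "0 \<le> a"
    have "K * ((a *\<^sub>R \<gamma> - 1) * (a *\<^sub>R \<gamma> - 1)) = K - K * (a *\<^sub>R (\<gamma> + \<gamma>) - (a * a) *\<^sub>R (\<gamma> * \<gamma>))"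
      by (simp add: algebra_simps)
    then have "K - Y \<le> K * ((a *\<^sub>R \<gamma> - 1) * (a *\<^sub>R \<gamma> - 1))"
      using approx(1)[OF a] by simp
    moreover have "0 \<le> K * ((a *\<^sub>R \<gamma> - 1) * (a *\<^sub>R \<gamma> - 1))"
      using K0 square_nonneg by (rule mult_nonneg_nonneg)
    ultimately show "D \<le> K * ((a *\<^sub>R \<gamma> - 1) * (a *\<^sub>R \<gamma> - 1))"
      by (simp add: D_def pprt_def)
  qed
  \<comment> \<open>On the support of \<open>D\<close>, where \<open>\<gamma>\<close> vanishes, the
    second bound loses its quadratic term and bounds all multiples of \<open>K\<close>.\<close>
  have "D * (K + K) \<le> 0"
  proof (rule le_0_of_scaleR_le)
    fix a :: real assume a: "0 < a"
    have "D * (a *\<^sub>R (K + K) - (a * a) *\<^sub>R (\<gamma> * K)) \<le> D * M"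
      using approx(2)[of a] a D0 by (intro mult_left_mono) auto
    moreover have "D * (\<gamma> * K) = 0"
      using \<open>D * \<gamma> = 0\<close> by (simp flip: mult.assoc)
    ultimately show "a *\<^sub>R (D * (K + K)) \<le> D * M"
      by (simp add: right_diff_distrib)
  qed
  then have "D * K \<le> 0" by (simp add: distrib_left)
  moreover have "D * D \<le> D * K" using DK D0 by (rule mult_left_mono)
  ultimately have "D * D = 0" using D0 by (intro order.antisym) simp_all
  then have "D = 0" by (rule unital_square_eq_0)
  then have "K \<le> Y" by (simp add: D_def flip: le_zero_iff_zero_pprt)
  then show ?thesis by (simp add: K_def Y_def j_le_iff)
qed

lemma \<omega>_mult_T: "\<omega> * T (g * h) = T g * T h"
proof -
  have *: "\<omega> * T ((g1 - g2) * (h1 - h2)) = T (g1 - g2) * T (h1 - h2)"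
    if "0 \<le> g1" "0 \<le> g2" "0 \<le> h1" "0 \<le> h2" for g1 g2 h1 h2
  proof -
    have "\<omega> * T (g * h) = T g * T h" if "0 \<le> g" "0 \<le> h" for g h
      using that \<omega>_mult_le \<omega>_mult_ge by (simp add: order.antisym)
    then show ?thesis
      using that by (simp add: left_diff_distrib right_diff_distrib diff)
  qed
  from *[of "pprt g" "pprt (- g)" "pprt h" "pprt (- h)"]
  show ?thesis by (simp add: pprt_diff_pprt_minus)
qed

text \<open>After multiplication by \<open>T g\<close>, both sides become the image of
  \<open>T f * T g\<close>, the right one by \<open>\<omega>_mult_T\<close>. Both kill the
  annihilator.\<close>

lemma factorization: "j (T f) = j \<omega> * C f"
proof (rule quotient_eqI)
  show "j (T f) * j (T g) = j \<omega> * C f * j (T g)" for g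
    by (simp only: mult.assoc C_mult_T \<omega>_mult_T flip: j_mult) (simp add: mult.commute)
  show "j (T f) * j z = j \<omega> * C f * j z" if "z \<in> annihilator" for z
    using that by (simp add: mult.assoc C_mult_annihilator annihilatorD j_0 flip: j_mult)
qed

end


section \<open>The embedding through the orthomorphisms\<close>

lemma mult_op_in_Orth: "mult_op f \<in> Orth"
  for f :: "'b::f_algebra"
proof -
  have "linear (mult_op f)"
    by (rule linearI) (simp_all add: mult_op_def distrib_left)
  moreover have "order_bounded_op (mult_op f)"
    unfolding order_bounded_op_def
  proof (intro allI)
    fix a b :: 'b
    have "f * x \<in> {f * a - \<bar>f\<bar> * (b - a) .. f * a + \<bar>f\<bar> * (b - a)}" if "x \<in> {a..b}" for x
    proof -
      have "\<bar>f * (x - a)\<bar> \<le> \<bar>f\<bar> * (b - a)"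
        using that by (simp add: abs_mult_right mult_left_mono)
      then have "f * (x - a) \<le> \<bar>f\<bar> * (b - a)" "- (f * (x - a)) \<le> \<bar>f\<bar> * (b - a)"
        by (simp_all only: abs_le_iff)
      then show ?thesis
        by (simp add: algebra_simps)
    qed
    then show "\<exists>c d. mult_op f ` {a..b} \<subseteq> {c..d}"
      unfolding mult_op_def by blast
  qed
  moreover have "inf \<bar>mult_op f x\<bar> \<bar>y\<bar> = 0" if "inf \<bar>x\<bar> \<bar>y\<bar> = 0" for x y
    using f_mult_left[OF that, of "\<bar>f\<bar>"] by (simp add: mult_op_def f_abs_mult)
  ultimately show ?thesis by (simp add: Orth_def)
qed

context
  fixes i :: "('b::semiprime_f_algebra \<Rightarrow> 'b) \<Rightarrow> 'e::{unital_f_algebra, conditionally_complete_lattice}"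
  assumes i: "dedekind_completion_of_Orth i"
begin

lemma completion_add: "\<pi> \<in> Orth \<Longrightarrow> \<rho> \<in> Orth \<Longrightarrow> i (\<lambda>x. \<pi> x + \<rho> x) = i \<pi> + i \<rho>"
  and completion_scaleR: "\<pi> \<in> Orth \<Longrightarrow> i (\<lambda>x. r *\<^sub>R \<pi> x) = r *\<^sub>R i \<pi>"
  and completion_comp: "\<pi> \<in> Orth \<Longrightarrow> \<rho> \<in> Orth \<Longrightarrow> i (\<pi> \<circ> \<rho>) = i \<pi> * i \<rho>"
  using i by (simp_all add: dedekind_completion_of_Orth_def)

lemma completion_le_iff: "\<pi> \<in> Orth \<Longrightarrow> \<rho> \<in> Orth \<Longrightarrow> i \<pi> \<le> i \<rho> \<longleftrightarrow> op_le \<pi> \<rho>"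
  using i by (simp add: dedekind_completion_of_Orth_def)

lemma completion_majorizing: "\<exists>\<pi>\<in>Orth. x \<le> i \<pi>"
  using i by (simp add: dedekind_completion_of_Orth_def)

lemma linear_completion_mult_op: "linear (\<lambda>f. i (mult_op f))"
proof (rule linearI)
  fix f g :: 'b and r :: real
  have "i (\<lambda>x. mult_op f x + mult_op g x) = i (mult_op f) + i (mult_op g)"
    "i (\<lambda>x. r *\<^sub>R mult_op f x) = r *\<^sub>R i (mult_op f)"
    by (rule completion_add completion_scaleR; rule mult_op_in_Orth)+
  moreover have "mult_op (f + g) = (\<lambda>x. mult_op f x + mult_op g x)"
    "mult_op (r *\<^sub>R f) = (\<lambda>x. r *\<^sub>R mult_op f x)"
    by (auto simp: mult_op_def distrib_right)
  ultimately show "i (mult_op (f + g)) = i (mult_op f) + i (mult_op g)"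
    "i (mult_op (r *\<^sub>R f)) = r *\<^sub>R i (mult_op f)"
    by simp_all
qed

lemma completion_mult_op_mult: "i (mult_op (f * g)) = i (mult_op f) * i (mult_op g)"
proof -
  have "i (mult_op f \<circ> mult_op g) = i (mult_op f) * i (mult_op g)"
    by (intro completion_comp mult_op_in_Orth)
  moreover have "mult_op (f * g) = mult_op f \<circ> mult_op g"
    by (auto simp: mult_op_def mult.assoc)
  ultimately show ?thesis by simp
qed

lemma completion_mult_op_mono: "f \<le> g \<Longrightarrow> i (mult_op f) \<le> i (mult_op g)"
  using completion_le_iff[OF mult_op_in_Orth mult_op_in_Orth, of f g]
  by (simp add: op_le_def mult_op_def mult_right_mono)

lemma regular_separating_completion:
  fixes T :: "'a::semiprime_f_algebra \<Rightarrow> 'b"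
  assumes reg: "regular_op T" and sep: "separating T"
  shows "regular_separating (\<lambda>f. i (mult_op (T f)))"
proof
  let ?e = "\<lambda>f. i (mult_op f)"
  note lin = linear_completion_mult_op
  obtain P N where P: "positive_op P" and N: "positive_op N" and T: "T = (\<lambda>x. P x - N x)"
    using reg by (auto simp: regular_op_def)
  have e0: "?e 0 = 0" using lin by (rule linear_0)
  have "positive_op (\<lambda>x. ?e (R x))" if "positive_op R" for R :: "'a \<Rightarrow> 'b"
    using that linear_compose[OF _ lin, of R] completion_mult_op_mono[of 0] e0
    by (auto simp: positive_op_def o_def)
  then show "regular_op (\<lambda>x. ?e (T x))"
    unfolding regular_op_def
    using P N linear_diff[OF lin]
    by (intro exI[of _ "\<lambda>x. ?e (P x)"] exI[of _ "\<lambda>x. ?e (N x)"]) (simp add: T)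
  show "separating (\<lambda>x. ?e (T x))"
    using sep e0 by (auto simp: separating_def simp flip: completion_mult_op_mult)
qed

lemma abs_completion_mult_op_le: "\<bar>i (mult_op f)\<bar> \<le> i (mult_op \<bar>f\<bar>)"
proof (rule abs_leI)
  show "i (mult_op f) \<le> i (mult_op \<bar>f\<bar>)" by (intro completion_mult_op_mono abs_ge_self)
  have "- i (mult_op f) = i (mult_op (- f))"
    using linear_neg[OF linear_completion_mult_op] by simp
  then show "- i (mult_op f) \<le> i (mult_op \<bar>f\<bar>)"
    by (simp add: completion_mult_op_mono abs_ge_minus_self)
qed

text \<open>The order embedding transfers the bounds for \<open>f\<close> and \<open>- f\<close>
  separately; on positive \<open>x\<close> they combine to a bound for the absolute value of
  \<open>f * x\<close>.\<close>

lemma op_le_abs_of_completion_le: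
  assumes \<pi>: "\<pi> \<in> Orth" and le: "\<bar>i (mult_op f)\<bar> \<le> i \<pi>"
  shows "op_le (mult_op \<bar>f\<bar>) \<pi>"
proof -
  have "i (mult_op f) \<le> i \<pi>" "i (mult_op (- f)) \<le> i \<pi>"
    using le linear_neg[OF linear_completion_mult_op, of f] by (auto simp: abs_le_iff)
  then have "op_le (mult_op f) \<pi>" "op_le (mult_op (- f)) \<pi>"
    using completion_le_iff[OF mult_op_in_Orth \<pi>] by auto
  then have "\<bar>f * x\<bar> \<le> \<pi> x" if "0 \<le> x" for x
    using that by (auto simp: op_le_def mult_op_def intro!: abs_leI)
  then show ?thesis by (simp add: op_le_def mult_op_def abs_mult_right)
qed

end


section \<open>Composition operators on the unit interval\<close>

text \<open>The powers of \<open>C f\<close> are the values of \<open>C\<close> at elements of \<open>{0..f}\<close>, hence bounded.\<close>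

lemma composition_ops_abs_le_one:
  fixes C :: "'a::semiprime_f_algebra \<Rightarrow> 'q::unital_f_algebra"
  assumes C: "C \<in> composition_ops" and f: "f \<in> unit_interval"
  shows "\<bar>C f\<bar> \<le> 1"
proof -
  obtain P N where P: "positive_op P" and N: "positive_op N" and C_eq: "C = (\<lambda>x. P x - N x)"
    using C by (auto simp: composition_ops_def regular_op_def)
  have C_mult: "C (x * y) = C x * C y" for x y
    using C by (simp add: composition_ops_def)
  define M where "M = P f + N f"
  \<comment> \<open>This is the power of \<open>f\<close> with exponent \<open>n + 1\<close>;
    without a unit there is no exponent 0.\<close>
  define p where "p n = (((*) f) ^^ n) f" for n :: nat
  have p: "0 \<le> p n \<and> p n \<le> f" for n
  proof (induction n)
    case 0
    then show ?case using f by (simp add: p_def unit_interval_def)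
  next
    case (Suc n)
    then have "f * p n \<le> p n" "0 \<le> f * p n"
      using f by (simp_all add: unit_interval_def op_le_def mult_op_def)
    then show ?case using Suc by (auto simp: p_def intro: order_trans)
  qed
  have bound: "\<bar>C (p n)\<bar> \<le> M" for n
  proof -
    have "0 \<le> R x" if "positive_op R" "0 \<le> x" for R :: "'a \<Rightarrow> 'q" and x
      using that by (simp add: positive_op_def)
    moreover have "R x \<le> R y" if "positive_op R" "x \<le> y" for R :: "'a \<Rightarrow> 'q" and x y
    proof -
      have "0 \<le> R (y - x)" using that by (simp add: positive_op_def)
      then show ?thesis using that by (simp add: positive_op_def linear_diff)
    qed
    ultimately have "0 \<le> P (p n)" "0 \<le> N (p n)" "P (p n) \<le> P f" "N (p n) \<le> N f"
      using P N p by simp_all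
    then show ?thesis
      using abs_triangle_ineq4[of "P (p n)" "N (p n)"] add_mono[of "P (p n)" "P f" "N (p n)" "N f"]
      by (simp add: C_eq M_def)
  qed
  define c where "c = \<bar>C f\<bar>"
  define u where "u = pprt (c - 1)"
  have u0: "0 \<le> u" and c0: "0 \<le> c" by (simp_all add: u_def c_def)
  have "u * (c - 1) = u * u" by (simp add: u_def pprt_mult_self)
  then have cu: "c * u = u + u * u" by (simp add: right_diff_distrib algebra_simps)
  \<comment> \<open>This is a form of Bernoulli's inequality: on the support of \<open>u\<close>,
    \<open>c\<close> equals \<open>1 + u\<close>, so its powers grow at least linearly.\<close>
  have grow: "real n *\<^sub>R (u * u) \<le> \<bar>C (p n)\<bar> * u" for n
  proof -
    have "u + real n *\<^sub>R (u * u) \<le> \<bar>C (p n)\<bar> * u"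
    proof (induction n)
      case 0
      then show ?case using cu u0 by (simp add: p_def flip: c_def)
    next
      case (Suc n)
      have "u + real (Suc n) *\<^sub>R (u * u) \<le> u + real (Suc n) *\<^sub>R (u * u) + real n *\<^sub>R (u * u * u)"
        using u0 by (simp add: scaleR_nonneg_nonneg)
      also have "\<dots> = c * u + real n *\<^sub>R (c * u * u)"
        by (simp add: cu algebra_simps)
      also have "\<dots> = c * (u + real n *\<^sub>R (u * u))"
        by (simp add: distrib_left mult.assoc)
      also have "\<dots> \<le> c * (\<bar>C (p n)\<bar> * u)"
        using Suc c0 by (rule mult_left_mono)
      also have "\<dots> = \<bar>C (p (Suc n))\<bar> * u"
        by (simp add: c_def p_def C_mult f_abs_mult mult.assoc)
      finally show ?case .
    qed
    then show ?thesis using u0 by (meson add_increasing order_refl order_trans)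
  qed
  have "u * u \<le> 0"
  proof (rule archimedean_le_0)
    show "real n *\<^sub>R (u * u) \<le> M * u" for n
      using grow[of n] mult_right_mono[OF bound u0, of n] by (rule order_trans)
  qed
  then have "u * u = 0" using square_nonneg[of u] by (rule order.antisym)
  then have "u = 0" by (rule unital_square_eq_0)
  then show ?thesis by (simp add: u_def c_def flip: le_zero_iff_zero_pprt)
qed

section \<open>Equivalence of almost contractivity and factorization\<close>

theorem theorem10:
  fixes T :: "'a::semiprime_f_algebra \<Rightarrow> 'b::semiprime_f_algebra"
    and i :: "('b \<Rightarrow> 'b) \<Rightarrow> 'e::{unital_f_algebra, conditionally_complete_lattice}"
    and j :: "'e \<Rightarrow> 'q::unital_f_algebra"
  assumes "dedekind_completion_of_Orth i"
    and "maximal_quotient_f_algebra j"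
    and "regular_op T"
    and "separating T"
  shows "almost_contractive T \<longleftrightarrow>
    (\<exists>\<omega>::'e. \<exists>C::'a \<Rightarrow> 'q. C \<in> composition_ops \<and>
       (\<forall>f. j (i (mult_op (T f))) = j \<omega> * C f))"
proof -
  let ?T = "\<lambda>f. i (mult_op (T f))"
  interpret separating_quotient ?T j
    using regular_separating_completion[OF assms(1,3,4)] assms(2)
    by (simp add: separating_quotient_def separating_quotient_axioms_def)
  show ?thesis
  proof
    assume "almost_contractive T"
    then obtain \<pi> where \<pi>: "\<pi> \<in> Orth" "\<And>f. f \<in> unit_interval \<Longrightarrow> op_le (mult_op \<bar>T f\<bar>) \<pi>"
      by (auto simp: almost_contractive_def)
    interpret almost_contractive_quotient ?T j "i \<pi>"
    proof
      fix u :: 'a assume "u \<in> unit_interval"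
      then have "i (mult_op \<bar>T u\<bar>) \<le> i \<pi>"
        using \<pi> completion_le_iff[OF assms(1) mult_op_in_Orth] by blast
      with abs_completion_mult_op_le[OF assms(1)] show "\<bar>?T u\<bar> \<le> i \<pi>"
        by (rule order_trans)
    qed
    show "\<exists>\<omega>::'e. \<exists>C::'a \<Rightarrow> 'q. C \<in> composition_ops \<and> (\<forall>f. j (?T f) = j \<omega> * C f)"
      using C_composition factorization by blast
  next
    assume "\<exists>\<omega>::'e. \<exists>C::'a \<Rightarrow> 'q. C \<in> composition_ops \<and> (\<forall>f. j (?T f) = j \<omega> * C f)"
    then obtain w :: 'e and C :: "'a \<Rightarrow> 'q"
      where C: "C \<in> composition_ops" and fact: "\<And>f. j (?T f) = j w * C f"
      by blast
    have j_abs: "\<bar>j x\<bar> = j \<bar>x\<bar>" for x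
      by (simp add: abs_lattice j_sup j_neg)
    \<comment> \<open>The element \<open>w\<close> lives in the completion; majorization supplies
      the orthomorphism that almost contractivity asks for.\<close>
    obtain \<pi> where \<pi>: "\<pi> \<in> Orth" "\<bar>w\<bar> \<le> i \<pi>"
      using completion_majorizing[OF assms(1)] by blast
    have "op_le (mult_op \<bar>T f\<bar>) \<pi>" if "f \<in> unit_interval" for f
    proof (rule op_le_abs_of_completion_le[OF assms(1) \<pi>(1)])
      have "j \<bar>?T f\<bar> = j \<bar>w\<bar> * \<bar>C f\<bar>"
        by (simp add: fact f_abs_mult flip: j_abs)
      also have "\<dots> \<le> j \<bar>w\<bar> * 1"
        using composition_ops_abs_le_one[OF C that] by (intro mult_left_mono) (simp_all flip: j_abs)
      finally have "\<bar>?T f\<bar> \<le> \<bar>w\<bar>" by (simp add: j_le_iff)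
      then show "\<bar>?T f\<bar> \<le> i \<pi>" using \<pi>(2) by (rule order_trans)
    qed
    then show "almost_contractive T"
      using \<pi>(1) by (auto simp: almost_contractive_def)
  qed
qed

end
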